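(* Let $A^\alpha$ be a smooth real 4-vector field on Minkowski space, let $\zeta$ be a real constant, and let $\theta_\alpha=M_\alpha:=iA_\alpha e^{\zeta\mathcal J}$. Then $$L_V=-32\cos2\zeta\,\bigl[(\partial_\alpha A^\beta)(\partial^\alpha A_\beta)-(\partial_\alpha A^\beta)(\partial_\beta A^\alpha)\bigr].$$ If $\tau\ne0$ is a real constant and $\cos2\zeta\neq0$, then the field equation obtained by varying $L=L_K-\tau L_V$ with respect to $A^\alpha$ is $$\partial_\beta\partial^\beta A_\alpha-\partial_\alpha\partial_\beta A^\beta=\frac{i}{64\,\tau\cos2\zeta}\,\psi^\dagger\hat\eta\gamma_\alpha e^{\zeta\mathcal J}\psi .$$
   Context: Minkowski space is $\mathbb R^4$ with coordinates $x^\alpha$ and constant metric $\eta=\mathrm{diag}(1,-1,-1,-1)$; indices are raised and lowered with $\eta$, and repeated indices are summed. The complex exterior algebra $\bigwedge_*$ of $\mathbb R^4$ has basis $\mathbf e_I=\mathbf e_{\alpha_1}\wedge\cdots\wedge\mathbf e_{\alpha_k}$, $\alpha_1<\dots<\alpha_k$, $|I|=k$ ($\mathbf e_\emptyset=1$); $16\times16$ matrices are operators on it in this basis and $\dagger$ is conjugate transpose. Gamma matrices: $\gamma_\alpha\psi=\mathbf e_\alpha\wedge\psi-\iota_\alpha\psi$, where $\iota_\alpha$ is the linear operator with $\iota_\alpha\mathbf e_\emptyset=0$, $\iota_\alpha\mathbf e_\beta=\eta_{\alpha\beta}\mathbf e_\emptyset$, $\iota_\alpha(\mathbf e_I\wedge\mathbf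 e_J)=(\iota_\alpha\mathbf e_I)\wedge\mathbf e_J+(-1)^{|I|}\mathbf e_I\wedge\iota_\alpha\mathbf e_J$. Extended metric: $\hat\eta_{IJ}=0$ if $|I|\ne|J|$, and $\hat\eta_{IJ}=\det(\eta_{\alpha_i\beta_j})$ if $I=\alpha_1\cdots\alpha_k$, $J=\beta_1\cdots\beta_k$. $\Theta_I$ is the $16\times16$ matrix that commutes with all gamma matrices and satisfies $\Theta_I\mathbf e_\emptyset=\mathbf e_I$; $\mathcal J=\Theta_{0123}$, which satisfies $\mathcal J^2=-\mathcal I$ ($\mathcal I$ the identity), and $e^{\zeta\mathcal J}=\cos\zeta\,\mathcal I+\sin\zeta\,\mathcal J$. Given four matrix-valued fields $\theta_\alpha$, put $\Omega_{\alpha\beta}=\partial_\alpha\theta_\beta-\partial_\beta\theta_\alpha+\theta_\alpha\theta_\beta-\theta_\beta\theta_\alpha$ and $$L_V=\tfrac12\,\mathrm{tr}(\Omega_{\alpha\beta}\Omega^{\alpha\beta})+c.c.$$ For a smooth field $\psi:\mathbb R^4\to\bigwedge_*\cong\mathbb C^{16}$ and a real constant $m$, put $D\psi=\gamma^\alpha(\partial_\alpha\psi+\theta_\alpha\psi)$ and $$L_K=\tfrac12\psi^\dagger\hat\eta D\psi+c.c.-m\,\psi^\dagger\hat\eta\psi ,$$ where $c.c.$ is the complex conjugate of the preceding term. "The field equation obtained by varying $L$" with respect to a field means its Euler–Lagrange equation (stationarity of $\int L\,d^4x$ under compactly supported variations of that field, with $\psi$ fixed). *)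

theory Defs
  imports "HOL-Analysis.Analysis"
begin

section \<open>Minkowski space\<close>

text \<open>
  Space-time indices are the elements 0, 1, 2, 3 of the type \<^typ>\<open>4\<close>, with the linear order
  0 < 1 < 2 < 3 of that type (where the numeral 4 denotes 0). Vectors \<^typ>\<open>real^4\<close> carry
  contravariant components.
\<close>

definition eta :: "4 \<Rightarrow> 4 \<Rightarrow> real" where
  "eta \<alpha> \<beta> = (if \<alpha> \<noteq> \<beta> then 0 else if \<alpha> = 0 then 1 else -1)"

definition pd :: "4 \<Rightarrow> (real^4 \<Rightarrow> 'b::real_normed_vector) \<Rightarrow> real^4 \<Rightarrow> 'b" where
  "pd \<alpha> f x = frechet_derivative f (at x) (axis \<alpha> 1)"

text \<open>Since eta is its own inverse, it also serves as the metric with upper indices.\<close>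

definition pd_up :: "4 \<Rightarrow> (real^4 \<Rightarrow> 'b::real_normed_vector) \<Rightarrow> real^4 \<Rightarrow> 'b" where
  "pd_up \<alpha> f x = (\<Sum>\<beta>\<in>UNIV. eta \<alpha> \<beta> *\<^sub>R pd \<beta> f x)"

definition lower :: "(real^4 \<Rightarrow> real^4) \<Rightarrow> 4 \<Rightarrow> real^4 \<Rightarrow> real" where
  "lower A \<alpha> x = (\<Sum>\<beta>\<in>UNIV. eta \<alpha> \<beta> * A x $ \<beta>)"

primrec times_cont_diff :: "nat \<Rightarrow> (real^4 \<Rightarrow> 'b::real_normed_vector) \<Rightarrow> bool" where
  "times_cont_diff 0 f \<longleftrightarrow> continuous_on UNIV f"
| "times_cont_diff (Suc k) f \<longleftrightarrow>
     (\<forall>x. f differentiable (at x)) \<and> (\<forall>\<alpha>. times_cont_diff k (pd \<alpha> f))"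

definition smooth :: "(real^4 \<Rightarrow> 'b::real_normed_vector) \<Rightarrow> bool" where
  "smooth f \<longleftrightarrow> (\<forall>k. times_cont_diff k f)"


section \<open>The complex exterior algebra of Minkowski space\<close>

text \<open>
  A basis element is given by the set of its indices, so a multivector has 16 complex components;
  operators are identified with their matrices.
\<close>

type_synonym multivector = "complex ^ (4 set)"
type_synonym operator = "complex ^ (4 set) ^ (4 set)"

definition basis_e :: "4 set \<Rightarrow> multivector" where
  "basis_e I = axis I 1"

text \<open>
  The sign of the permutation that sorts the increasing enumeration of \<open>I\<close> followed by that of \<open>J\<close>.
\<close>

definition shuffle_sign :: "4 set \<Rightarrow> 4 set \<Rightarrow> complex" where
  "shuffle_sign I J = (-1) ^ card {(i, j). i \<in> I \<and> j \<in> J \<and> j < i}"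

definition wedge :: "multivector \<Rightarrow> multivector \<Rightarrow> multivector" where
  "wedge \<phi> \<psi> = (\<Sum>I\<in>UNIV. \<Sum>J\<in>UNIV.
     if I \<inter> J = {} then (\<phi> $ I * \<psi> $ J * shuffle_sign I J) *s basis_e (I \<union> J) else 0)"

definition interior_op :: "4 \<Rightarrow> operator" where
  "interior_op \<alpha> = (THE B.
     B *v basis_e {} = 0 \<and>
     (\<forall>\<beta>. B *v basis_e {\<beta>} = of_real (eta \<alpha> \<beta>) *s basis_e {}) \<and>
     (\<forall>I J. B *v wedge (basis_e I) (basis_e J) =
        wedge (B *v basis_e I) (basis_e J)
        + (-1) ^ card I *s wedge (basis_e I) (B *v basis_e J)))"

definition gamma :: "4 \<Rightarrow> operator" where
  "gamma \<alpha> = matrix (\<lambda>\<psi>. wedge (basis_e {\<alpha>}) \<psi> - interior_op \<alpha> *v \<psi>)"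

definition gamma_up :: "4 \<Rightarrow> operator" where
  "gamma_up \<alpha> = (\<Sum>\<beta>\<in>UNIV. eta \<alpha> \<beta> *\<^sub>R gamma \<beta>)"

text \<open>
  The determinant of the k by k matrix with entries \<open>M i j\<close>, \<open>i, j < k\<close>, by the Leibniz formula;
  \<^const>\<open>det\<close> is not applicable because k depends on the index sets.
\<close>

definition det_nat :: "nat \<Rightarrow> (nat \<Rightarrow> nat \<Rightarrow> real) \<Rightarrow> real" where
  "det_nat k M = (\<Sum>p | p permutes {..<k}. of_int (sign p) * (\<Prod>i<k. M i (p i)))"

definition eta_hat :: operator where
  "eta_hat = (\<chi> I J. if card I \<noteq> card J then 0
     else of_real (det_nat (card I)
       (\<lambda>i j. eta (sorted_list_of_set I ! i) (sorted_list_of_set J ! j))))"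

definition Theta :: "4 set \<Rightarrow> operator" where
  "Theta I = (THE B. (\<forall>\<alpha>. B ** gamma \<alpha> = gamma \<alpha> ** B) \<and> B *v basis_e {} = basis_e I)"

definition JJ :: operator where
  "JJ = Theta {0, 1, 2, 3}"

primrec mat_power :: "operator \<Rightarrow> nat \<Rightarrow> operator" where
  "mat_power B 0 = mat 1"
| "mat_power B (Suc n) = B ** mat_power B n"

definition mat_exp :: "operator \<Rightarrow> operator" where
  "mat_exp B = (\<Sum>n. (1 / fact n) *\<^sub>R mat_power B n)"

definition expJ :: "real \<Rightarrow> operator" where
  "expJ \<zeta> = mat_exp (\<zeta> *\<^sub>R JJ)"


section \<open>Lagrangians\<close>

text \<open>A gauge field maps a lower space-time index and a point to an operator.\<close>

definition Omega :: "(4 \<Rightarrow> real^4 \<Rightarrow> operator) \<Rightarrow> 4 \<Rightarrow> 4 \<Rightarrow> real^4 \<Rightarrow> operator" where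
  "Omega \<theta> \<alpha> \<beta> x =
     pd \<alpha> (\<theta> \<beta>) x - pd \<beta> (\<theta> \<alpha>) x + \<theta> \<alpha> x ** \<theta> \<beta> x - \<theta> \<beta> x ** \<theta> \<alpha> x"

definition Omega_up :: "(4 \<Rightarrow> real^4 \<Rightarrow> operator) \<Rightarrow> 4 \<Rightarrow> 4 \<Rightarrow> real^4 \<Rightarrow> operator" where
  "Omega_up \<theta> \<alpha> \<beta> x =
     (\<Sum>\<mu>\<in>UNIV. \<Sum>\<nu>\<in>UNIV. (eta \<alpha> \<mu> * eta \<beta> \<nu>) *\<^sub>R Omega \<theta> \<mu> \<nu> x)"

definition plus_cc :: "complex \<Rightarrow> complex" where
  "plus_cc z = z + cnj z"

definition lagrangian_V :: "(4 \<Rightarrow> real^4 \<Rightarrow> operator) \<Rightarrow> real^4 \<Rightarrow> complex" where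
  "lagrangian_V \<theta> x = plus_cc
     (1/2 * trace (\<Sum>\<alpha>\<in>UNIV. \<Sum>\<beta>\<in>UNIV. Omega \<theta> \<alpha> \<beta> x ** Omega_up \<theta> \<alpha> \<beta> x))"

text \<open>The conjugate transpose of \<open>\<phi>\<close>, times \<^const>\<open>eta_hat\<close>, times \<open>\<psi>\<close>.\<close>

definition eta_form :: "multivector \<Rightarrow> multivector \<Rightarrow> complex" where
  "eta_form \<phi> \<psi> = (\<Sum>I\<in>UNIV. cnj (\<phi> $ I) * (eta_hat *v \<psi>) $ I)"

definition dirac_D :: "(4 \<Rightarrow> real^4 \<Rightarrow> operator) \<Rightarrow> (real^4 \<Rightarrow> multivector)
    \<Rightarrow> real^4 \<Rightarrow> multivector" where
  "dirac_D \<theta> \<psi> x = (\<Sum>\<alpha>\<in>UNIV. gamma_up \<alpha> *v (pd \<alpha> \<psi> x + \<theta> \<alpha> x *v \<psi> x))"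

definition lagrangian_K :: "real \<Rightarrow> (4 \<Rightarrow> real^4 \<Rightarrow> operator) \<Rightarrow> (real^4 \<Rightarrow> multivector)
    \<Rightarrow> real^4 \<Rightarrow> complex" where
  "lagrangian_K m \<theta> \<psi> x =
     plus_cc (1/2 * eta_form (\<psi> x) (dirac_D \<theta> \<psi> x)) - of_real m * eta_form (\<psi> x) (\<psi> x)"

definition M_field :: "real \<Rightarrow> (real^4 \<Rightarrow> real^4) \<Rightarrow> 4 \<Rightarrow> real^4 \<Rightarrow> operator" where
  "M_field \<zeta> A \<alpha> x = map_matrix ((*) (\<i> * of_real (lower A \<alpha> x))) (expJ \<zeta>)"

definition total_lagrangian :: "real \<Rightarrow> real \<Rightarrow> real \<Rightarrow> (real^4 \<Rightarrow> multivector)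
    \<Rightarrow> (real^4 \<Rightarrow> real^4) \<Rightarrow> real^4 \<Rightarrow> complex" where
  "total_lagrangian m \<tau> \<zeta> \<psi> A x =
     lagrangian_K m (M_field \<zeta> A) \<psi> x - of_real \<tau> * lagrangian_V (M_field \<zeta> A) x"

text \<open>
  \<open>stationary L A\<close> is the Euler-Lagrange equation of the Lagrangian density \<open>L\<close> at the field \<open>A\<close>.
  The action over all of space-time need not converge, so it is taken over any compact region
  that contains the support of the variation \<open>h\<close>.
\<close>

definition stationary :: "((real^4 \<Rightarrow> real^4) \<Rightarrow> real^4 \<Rightarrow> complex) \<Rightarrow> (real^4 \<Rightarrow> real^4) \<Rightarrow> bool" where
  "stationary L A \<longleftrightarrow>
     (\<forall>h K. smooth h \<longrightarrow> compact K \<longrightarrow> closure {x. h x \<noteq> 0} \<subseteq> K \<longrightarrow>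
       ((\<lambda>\<epsilon>. LINT x:K|lborel. L (\<lambda>y. A y + \<epsilon> *\<^sub>R h y) x) has_vector_derivative 0) (at 0))"

end

theory Submission
  imports Defs
begin

text \<open>
  On basis vectors, the gamma matrices and the operator J act by signed permutations, which gives
  \<open>J\<^sup>2 = -1\<close>, trace J = 0, and that with respect to the extended metric the gamma matrices are
  anti-self-adjoint and J is self-adjoint. So exp(zeta J) = cos zeta + sin zeta J, the trace of its
  square is 16 cos(2 zeta), and the current \<open>i \<psi>\<^sup>\<dagger> \<eta> \<gamma> e \<psi>\<close> (with e = exp(zeta J)) is real.
  Since M is a multiple of one fixed matrix, the commutator in Omega vanishes and the Lagrangian is a
  quadratic polynomial in A and its first derivatives. Hence the action at A + eps h is a quadratic
  polynomial in eps; its linear coefficient is, up to a divergence, the integral of h times the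
  Euler-Lagrange expression, and the fundamental lemma of the calculus of variations applies.
\<close>

section \<open>Gamma matrices\<close>

text \<open>The interior product and J are given by definite descriptions, so they become computable
  only once an explicit signed matrix is exhibited and shown to be the unique solution; uniqueness
  comes in both cases from building e_I one index at a time. As \<open>eta\<close> is diagonal with
  entries 1 and -1, raising or lowering an index is just multiplication by
  \<open>eta \<alpha> \<alpha>\<close>, and every sign below is its own inverse. Origin of the
  constants: F F with all indices contracted is twice the bracket in L_V, the trace contributes 16
  cos(2 zeta), the square of i contributes -1, and the factor 1/2 is undone by adding the conjugate;
  this gives -32. The cross term of the quadratic form doubles 32 to 64. The reality of the current
  matters because adding the conjugate in L_K keeps only the real part of the coupling, while the
  field equation carries the full complex expression. The compact set K in \<open>stationary\<close>
  is arbitrary and may have a wild boundary, so divergences are integrated by translation invariance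
  and not by a boundary formula.\<close>

lemma matrix_mult_basis_e: "(B *v basis_e I) $ K = B $ K $ I" for B :: operator
  by (simp add: basis_e_def axis_def matrix_vector_mult_def if_distrib cong: if_cong)

lemma basis_e_component: "basis_e I $ K = (if K = I then 1 else 0)"
  by (simp add: basis_e_def axis_def)

lemma operator_eqI:
  fixes B C :: operator
  assumes "\<And>I. B *v basis_e I = C *v basis_e I"
  shows "B = C"
  by (metis (no_types, lifting) assms matrix_mult_basis_e vec_eq_iff)

lemma eta_sq [simp]: "eta \<alpha> \<alpha> * eta \<alpha> \<alpha> = 1" "eta \<alpha> \<alpha> * (eta \<alpha> \<alpha> * r) = r"
  by (simp_all add: eta_def)

text \<open>Only the diagonal term survives. From here on all index raising and lowering is done by
  the sign \<open>eta \<alpha> \<alpha>\<close>, without a sum.\<close>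

lemma sum_eta: "(\<Sum>\<beta>\<in>UNIV. eta \<alpha> \<beta> *\<^sub>R f \<beta>) = eta \<alpha> \<alpha> *\<^sub>R f \<alpha>" for f :: "4 \<Rightarrow> 'a::real_vector"
proof -
  have "(\<Sum>\<beta>\<in>UNIV. eta \<alpha> \<beta> *\<^sub>R f \<beta>) = (\<Sum>\<beta>\<in>UNIV. if \<alpha> = \<beta> then eta \<alpha> \<alpha> *\<^sub>R f \<alpha> else 0)"
    by (intro sum.cong) (auto simp: eta_def)
  then show ?thesis by simp
qed

section \<open>Signs of reorderings of index sets\<close>

definition lo_sign :: "4 \<Rightarrow> 4 set \<Rightarrow> complex" where
  "lo_sign a I = (-1) ^ card {i \<in> I. i < a}"

text \<open>Both signs come from moving a factor e_a to its place in the increasing product over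
  \<open>I\<close>: from the front it passes the indices below \<open>a\<close>, which gives
  \<open>lo_sign\<close>, from the back those above \<open>a\<close>, which gives
  \<open>hi_sign\<close>.\<close>

definition hi_sign :: "4 \<Rightarrow> 4 set \<Rightarrow> complex" where
  "hi_sign a I = (-1) ^ card {i \<in> I. a < i}"

lemma lo_sign_sq [simp]: "lo_sign a I * lo_sign a I = 1" "lo_sign a I * (lo_sign a I * z) = z"
  by (simp_all add: lo_sign_def power_mult_distrib [symmetric] mult.assoc [symmetric])

lemma lo_sign_nz [simp]: "lo_sign a I \<noteq> 0"
  by (simp add: lo_sign_def)

lemma cnj_lo_sign [simp]: "cnj (lo_sign a I) = lo_sign a I"
  by (simp add: lo_sign_def)

lemma lo_sign_insert [simp]: "lo_sign a (insert a I) = lo_sign a I"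
  unfolding lo_sign_def by (rule arg_cong [where f = "\<lambda>S. _ ^ card S"]) auto

lemma lo_sign_Un:
  assumes "I \<inter> J = {}"
  shows "lo_sign a (I \<union> J) = lo_sign a I * lo_sign a J"
proof -
  have "{i \<in> I \<union> J. i < a} = {i \<in> I. i < a} \<union> {i \<in> J. i < a}" by auto
  moreover have "{i \<in> I. i < a} \<inter> {i \<in> J. i < a} = {}" using assms by auto
  ultimately show ?thesis by (simp add: lo_sign_def card_Un_disjoint power_add)
qed

text \<open>Moving e_a from the front to the back passes every index of \<open>I\<close> once. This
  splits the sign of the Leibniz rule into the two one-sided signs.\<close>

lemma lo_sign_mult_hi_sign:
  assumes "a \<notin> I"
  shows "lo_sign a I * hi_sign a I = (-1) ^ card I"
proof -
  have "{i \<in> I. i < a} \<union> {i \<in> I. a < i} = I" using assms by (auto simp: not_less order_le_less)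
  moreover have "{i \<in> I. i < a} \<inter> {i \<in> I. a < i} = {}" by auto
  ultimately have "card I = card {i \<in> I. i < a} + card {i \<in> I. a < i}"
    by (metis card_Un_disjoint finite)
  then show ?thesis by (simp add: lo_sign_def hi_sign_def power_add)
qed

lemma lo_sign_empty [simp]: "lo_sign a {} = 1"
  by (simp add: lo_sign_def)

lemma shuffle_sign_empty [simp]: "shuffle_sign {} J = 1"
  by (simp add: shuffle_sign_def)

text \<open>The additional inversions are exactly the pairs with first entry \<open>a\<close>; the
  elements of \<open>J\<close> below \<open>a\<close> count them.\<close>

lemma shuffle_sign_insert_left:
  assumes "a \<notin> I"
  shows "shuffle_sign (insert a I) J = lo_sign a J * shuffle_sign I J"
proof -
  have "{(i, j). i \<in> insert a I \<and> j \<in> J \<and> j < i}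
    = Pair a ` {j \<in> J. j < a} \<union> {(i, j). i \<in> I \<and> j \<in> J \<and> j < i}" by auto
  moreover have "Pair a ` {j \<in> J. j < a} \<inter> {(i, j). i \<in> I \<and> j \<in> J \<and> j < i} = {}"
    using assms by auto
  moreover have "card (Pair a ` {j \<in> J. j < a}) = card {j \<in> J. j < a}"
    by (rule card_image) (simp add: inj_on_def)
  ultimately show ?thesis
    by (simp add: shuffle_sign_def lo_sign_def card_Un_disjoint power_add)
qed

lemma shuffle_sign_insert_right:
  assumes "a \<notin> J"
  shows "shuffle_sign I (insert a J) = hi_sign a I * shuffle_sign I J"
proof -
  have "{(i, j). i \<in> I \<and> j \<in> insert a J \<and> j < i}
    = (\<lambda>i. (i, a)) ` {i \<in> I. a < i} \<union> {(i, j). i \<in> I \<and> j \<in> J \<and> j < i}" by auto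
  moreover have "(\<lambda>i. (i, a)) ` {i \<in> I. a < i} \<inter> {(i, j). i \<in> I \<and> j \<in> J \<and> j < i} = {}"
    using assms by auto
  moreover have "card ((\<lambda>i. (i, a)) ` {i \<in> I. a < i}) = card {i \<in> I. a < i}"
    by (rule card_image) (simp add: inj_on_def)
  ultimately show ?thesis
    by (simp add: shuffle_sign_def hi_sign_def card_Un_disjoint power_add)
qed

section \<open>The wedge product on basis elements\<close>

lemma wedge_basis_e:
  "wedge (basis_e I) (basis_e J) = (if I \<inter> J = {} then shuffle_sign I J *s basis_e (I \<union> J) else 0)"
proof -
  have "(if K \<inter> L = {} then (basis_e I $ K * basis_e J $ L * shuffle_sign K L) *s basis_e (K \<union> L) else 0)
    = (if L = J then if K = I then if I \<inter> J = {} then shuffle_sign I J *s basis_e (I \<union> J) else 0 else 0 else 0)"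
    for K L by (auto simp: basis_e_component)
  then show ?thesis by (simp add: wedge_def)
qed

lemma wedge_scale_left: "wedge (c *s \<phi>) \<psi> = c *s wedge \<phi> \<psi>"
  unfolding wedge_def vec_eq_iff
  by (auto simp: sum_distrib_left algebra_simps intro!: sum.cong)

lemma wedge_scale_right: "wedge \<phi> (c *s \<psi>) = c *s wedge \<phi> \<psi>"
  unfolding wedge_def vec_eq_iff
  by (auto simp: sum_distrib_left algebra_simps intro!: sum.cong)

lemma wedge_zero [simp]: "wedge 0 \<psi> = 0" "wedge \<phi> 0 = 0"
  by (simp_all add: wedge_def cong: if_cong)

lemma wedge_vector_basis_e:
  "wedge (basis_e {\<alpha>}) (basis_e I) = (if \<alpha> \<in> I then 0 else lo_sign \<alpha> I *s basis_e (insert \<alpha> I))"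
  by (simp add: wedge_basis_e shuffle_sign_insert_left)

text \<open>Explicit candidate for the interior product: bringing e_\<alpha> to the front of e_I
  costs \<open>lo_sign \<alpha> I\<close>, and the front factor is then replaced by
  \<open>eta \<alpha> \<alpha>\<close>. The other indices of \<open>I\<close> contribute nothing
  because \<open>eta\<close> is diagonal.\<close>

definition contraction :: "4 \<Rightarrow> operator" where
  "contraction \<alpha> = (\<chi> K I. if \<alpha> \<in> I \<and> K = I - {\<alpha>} then eta \<alpha> \<alpha> * lo_sign \<alpha> I else 0)"

lemma contraction_basis_e:
  "contraction \<alpha> *v basis_e I = (if \<alpha> \<in> I then (eta \<alpha> \<alpha> * lo_sign \<alpha> I) *s basis_e (I - {\<alpha>}) else 0)"
  by (simp add: vec_eq_iff matrix_mult_basis_e basis_e_component contraction_def)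

text \<open>The cases are whether \<alpha> occurs in \<open>I\<close> and in \<open>J\<close>. If it
  occurs in exactly one of them, one term survives on the right, and its sign matches because
  \<open>lo_sign\<close> is multiplicative on disjoint unions. If it occurs in both, the left side
  vanishes and the two terms on the right cancel, since removing \<alpha> from the first or from the
  second factor leaves the same product with opposite signs.\<close>

lemma contraction_wedge:
  "contraction \<alpha> *v wedge (basis_e I) (basis_e J) =
     wedge (contraction \<alpha> *v basis_e I) (basis_e J)
     + (-1) ^ card I *s wedge (basis_e I) (contraction \<alpha> *v basis_e J)"
proof -
  have sign: "lo_sign \<alpha> I' * hi_sign \<alpha> I' = (-1) ^ card I'" if "\<alpha> \<notin> I'" for I'
    using that by (rule lo_sign_mult_hi_sign)
  note simps = wedge_basis_e wedge_scale_left wedge_scale_right contraction_basis_e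
    shuffle_sign_insert_left shuffle_sign_insert_right vector_scalar_commute
  consider "\<alpha> \<notin> I" "\<alpha> \<notin> J" | I' where "\<alpha> \<notin> I'" "I = insert \<alpha> I'" "\<alpha> \<notin> J"
    | J' where "\<alpha> \<notin> J'" "J = insert \<alpha> J'" "\<alpha> \<notin> I"
    | I' J' where "\<alpha> \<notin> I'" "I = insert \<alpha> I'" "\<alpha> \<notin> J'" "J = insert \<alpha> J'"
    by (metis mk_disjoint_insert)
  then show ?thesis
  proof cases
    case 1
    then show ?thesis by (auto simp: simps)
  next
    case 2
    then have "insert \<alpha> I' \<union> J - {\<alpha>} = I' \<union> J" by auto
    with 2 show ?thesis
      by (auto simp: simps lo_sign_Un vector_smult_assoc mult_ac)
  next
    case 3
    then have "insert \<alpha> (I \<union> J') - {\<alpha>} = I \<union> J'" by auto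
    with 3 show ?thesis
      by (auto simp: simps lo_sign_Un vector_smult_assoc mult_ac sign [symmetric])
  next
    case 4
    then show ?thesis
      by (auto simp: simps lo_sign_Un vector_smult_assoc mult_ac sign [symmetric]
          vector_sadd_rdistrib [symmetric] vec_eq_iff)
  qed
qed

text \<open>For uniqueness, e_(insert a F) is up to the nonzero sign \<open>lo_sign a F\<close> the
  wedge of e_a and e_F, so the Leibniz rule together with the values on vectors determines the
  operator by induction on the index set.\<close>

lemma interior_op_eq: "interior_op \<alpha> = contraction \<alpha>"
  unfolding interior_op_def
proof (rule the_equality, intro conjI allI)
  show "contraction \<alpha> *v basis_e {} = 0"
    by (simp add: contraction_basis_e)
  show "contraction \<alpha> *v basis_e {\<beta>} = of_real (eta \<alpha> \<beta>) *s basis_e {}" for \<beta>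
    by (auto simp: contraction_basis_e eta_def)
  show "contraction \<alpha> *v wedge (basis_e I) (basis_e J) =
     wedge (contraction \<alpha> *v basis_e I) (basis_e J)
     + (-1) ^ card I *s wedge (basis_e I) (contraction \<alpha> *v basis_e J)" for I J
    by (rule contraction_wedge)
next
  fix B :: operator
  assume B: "B *v basis_e {} = 0 \<and>
     (\<forall>\<beta>. B *v basis_e {\<beta>} = of_real (eta \<alpha> \<beta>) *s basis_e {}) \<and>
     (\<forall>I J. B *v wedge (basis_e I) (basis_e J) =
        wedge (B *v basis_e I) (basis_e J)
        + (-1) ^ card I *s wedge (basis_e I) (B *v basis_e J))"
  have vec: "contraction \<alpha> *v basis_e {\<beta>} = of_real (eta \<alpha> \<beta>) *s basis_e {}" for \<beta>
    by (auto simp: contraction_basis_e eta_def)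
  show "B = contraction \<alpha>"
  proof (rule operator_eqI)
    fix I :: "4 set"
    have "finite I" by simp
    then show "B *v basis_e I = contraction \<alpha> *v basis_e I"
    proof induction
      case empty
      then show ?case using B by (simp add: contraction_basis_e)
    next
      case (insert a F)
      have "B *v wedge (basis_e {a}) (basis_e F) = contraction \<alpha> *v wedge (basis_e {a}) (basis_e F)"
        using B by (simp add: insert.IH contraction_wedge vec)
      then show ?case
        using insert.hyps
        by (simp add: wedge_vector_basis_e vector_scalar_commute vec.scale_left_imp_eq)
    qed
  qed
qed

section \<open>Gamma matrices as signed permutations\<close>

lemma gamma_basis_e:
  "gamma \<alpha> *v basis_e I = (if \<alpha> \<in> I then (- (eta \<alpha> \<alpha> * lo_sign \<alpha> I)) *s basis_e (I - {\<alpha>})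
     else lo_sign \<alpha> I *s basis_e (insert \<alpha> I))"
proof -
  have "gamma \<alpha> *v basis_e I = wedge (basis_e {\<alpha>}) (basis_e I) - interior_op \<alpha> *v basis_e I"
    unfolding vec_eq_iff matrix_mult_basis_e gamma_def matrix_def by (simp add: basis_e_def)
  then show ?thesis
    by (auto simp: interior_op_eq contraction_basis_e wedge_vector_basis_e vec_eq_iff)
qed

lemma gamma_component:
  "gamma \<alpha> $ K $ I = (if \<alpha> \<in> I then (if K = I - {\<alpha>} then - (eta \<alpha> \<alpha> * lo_sign \<alpha> I) else 0)
     else (if K = insert \<alpha> I then lo_sign \<alpha> I else 0))"
  unfolding matrix_mult_basis_e [symmetric] gamma_basis_e
  by (simp add: basis_e_component)

lemma matrix_vector_mult_uminus: "B *v (- x) = - (B *v x)" for B :: operator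
  by (simp add: vec_eq_iff matrix_vector_mult_def sum_negf)

text \<open>
  The signs of \<^const>\<open>JJ\<close> are forced by commutation with the gamma matrices: writing J e_I = c(I) e_(-I),
  adding an index a to I multiplies c by \<open>- eta a a\<close> times (-1)^(number of indices below a).
\<close>

definition hodge_sign :: "4 set \<Rightarrow> complex" where
  "hodge_sign I = (\<Prod>i\<in>I. - (lo_sign i UNIV * eta i i))"

definition hodge :: operator where
  "hodge = (\<chi> K I. if K = - I then hodge_sign I else 0)"

lemma hodge_basis_e: "hodge *v basis_e I = hodge_sign I *s basis_e (- I)"
  by (simp add: vec_eq_iff matrix_mult_basis_e basis_e_component hodge_def)

lemma lo_sign_Compl: "lo_sign a (- I) = lo_sign a UNIV * lo_sign a I"
proof -
  have "lo_sign a UNIV = lo_sign a I * lo_sign a (- I)"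
    using lo_sign_Un [of I "- I" a] by simp
  then show ?thesis by (simp add: mult_ac)
qed

lemma eta_sq_complex [simp]: "of_real (eta \<alpha> \<alpha>) * of_real (eta \<alpha> \<alpha>) = (1::complex)"
  "of_real (eta \<alpha> \<alpha>) * (of_real (eta \<alpha> \<alpha>) * z) = (z::complex)"
  by (simp_all add: eta_def)

lemma hodge_sign_insert:
  "a \<notin> I \<Longrightarrow> hodge_sign (insert a I) = - (lo_sign a UNIV * eta a a) * hodge_sign I"
  by (simp add: hodge_sign_def)

text \<open>Taking complements exchanges adding \<alpha> with removing \<alpha>, so the two sides
  always meet different branches of \<open>gamma_basis_e\<close>. The signs balance by the recursion
  \<open>hodge_sign_insert\<close> and because the indices below \<alpha> are divided between a set
  and its complement.\<close>

lemma hodge_commute: "hodge ** gamma \<alpha> = gamma \<alpha> ** hodge"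
proof (rule operator_eqI)
  fix I
  show "(hodge ** gamma \<alpha>) *v basis_e I = (gamma \<alpha> ** hodge) *v basis_e I"
  proof (cases "\<alpha> \<in> I")
    case True
    then obtain I' where "\<alpha> \<notin> I'" "I = insert \<alpha> I'" by (metis mk_disjoint_insert)
    moreover have "insert \<alpha> (- insert \<alpha> I') = - I'" using \<open>\<alpha> \<notin> I'\<close> by auto
    ultimately show ?thesis
      by (simp add: matrix_vector_mul_assoc [symmetric] gamma_basis_e hodge_basis_e
        vector_scalar_commute vector_smult_assoc hodge_sign_insert lo_sign_Compl
        matrix_vector_mult_uminus mult_ac)
  next
    case False
    moreover have "- insert \<alpha> I = - I - {\<alpha>}" by auto
    ultimately show ?thesis
      by (simp add: matrix_vector_mul_assoc [symmetric] gamma_basis_e hodge_basis_e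
        vector_scalar_commute vector_smult_assoc hodge_sign_insert lo_sign_Compl
        matrix_vector_mult_uminus mult_ac)
  qed
qed

lemma UNIV_4_from_0: "(UNIV :: 4 set) = {0, 1, 2, 3}"
  using UNIV_4 by auto

text \<open>An operator that commutes with the gamma matrices is determined by its value on e_{}:
  for \<open>a\<close> outside \<open>F\<close>, \<open>gamma a\<close> sends e_F to a nonzero
  multiple of e_(insert a F), so the gamma matrices reach every basis element from e_{}.\<close>

lemma JJ_eq: "JJ = hodge"
  unfolding JJ_def Theta_def
proof (rule the_equality, intro conjI allI)
  show "hodge ** gamma \<alpha> = gamma \<alpha> ** hodge" for \<alpha>
    by (rule hodge_commute)
  show "hodge *v basis_e {} = basis_e {0, 1, 2, 3}"
    by (simp add: hodge_basis_e UNIV_4_from_0 [symmetric] hodge_sign_def)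
next
  fix B :: operator
  assume B: "(\<forall>\<alpha>. B ** gamma \<alpha> = gamma \<alpha> ** B) \<and> B *v basis_e {} = basis_e {0, 1, 2, 3}"
  show "B = hodge"
  proof (rule operator_eqI)
    fix I :: "4 set"
    have "finite I" by simp
    then show "B *v basis_e I = hodge *v basis_e I"
    proof induction
      case empty
      then show ?case using B by (simp add: hodge_basis_e UNIV_4_from_0 [symmetric] hodge_sign_def)
    next
      case (insert a F)
      have "B *v (gamma a *v basis_e F) = hodge *v (gamma a *v basis_e F)"
        using B by (simp add: matrix_vector_mul_assoc hodge_commute) (simp add: matrix_vector_mul_assoc [symmetric] insert.IH)
      then show ?case
        using insert.hyps
        by (simp add: gamma_basis_e vector_scalar_commute vec.scale_left_imp_eq)
    qed
  qed
qed

section \<open>Square and trace of J\<close>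

lemma order_4: "\<not> (i::4) < 0" "(0::4) < 1" "(1::4) < 2" "(2::4) < 3"
  using Rep_bit0 [of i] by (simp_all add: less_bit0_def not_less bit0.Rep_0 bit0.Rep_1 bit0.Rep_numeral)

text \<open>The factors for the indices 0, 1, 2, 3 are -1, -1, 1, -1. The sign of J squared rests on
  this single product.\<close>

lemma hodge_sign_UNIV: "hodge_sign UNIV = -1"
proof -
  have *: "{i::4. i < 0} = {}" "{i::4. i < 1} = {0}" "{i::4. i < 2} = {0, 1}" "{i::4. i < 3} = {0, 1, 2}"
    using order_4 UNIV_4_from_0 by (auto simp: set_eq_iff)
  have "hodge_sign {0, 1, 2, 3} = -1"
    by (simp add: hodge_sign_def lo_sign_def eta_def *)
  then show ?thesis by (simp only: UNIV_4_from_0)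
qed

text \<open>Applying J twice leads from \<open>I\<close> to its complement and back, collecting one
  factor for every index of the space, hence the sign of the full set.\<close>

lemma hodge_sign_Compl: "hodge_sign I * hodge_sign (- I) = -1"
proof -
  have "hodge_sign I * hodge_sign (- I) = hodge_sign (I \<union> - I)"
    unfolding hodge_sign_def by (rule prod.union_disjoint [symmetric]) auto
  then show ?thesis by (simp add: hodge_sign_UNIV)
qed

lemma JJ_sq: "JJ ** JJ = - mat 1"
proof (rule operator_eqI)
  fix I
  have "(- mat 1 :: operator) *v x = - x" for x
    by (simp add: vec_eq_iff matrix_vector_mult_def mat_def sum_negf if_distrib if_distribR cong: if_cong)
  moreover have "(JJ ** JJ) *v basis_e I = (hodge_sign I * hodge_sign (- I)) *s basis_e I"
    by (simp add: JJ_eq matrix_vector_mul_assoc [symmetric] hodge_basis_e vector_scalar_commute vector_smult_assoc)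
  ultimately show "(JJ ** JJ) *v basis_e I = (- mat 1) *v basis_e I"
    by (simp add: hodge_sign_Compl)
qed

lemma trace_JJ: "trace JJ = 0"
proof -
  have "I \<noteq> - I" for I :: "4 set" by auto
  then show ?thesis by (simp add: trace_def JJ_eq hodge_def)
qed

lemma trace_mat_1: "trace (mat 1 :: operator) = 16"
  by (simp add: trace_def mat_def)

section \<open>The extended metric\<close>

text \<open>A Leibniz term is nonzero only if the permutation matches equal entries of the two
  sorted lists, because \<open>eta\<close> is diagonal. Matching all entries forces the sets to
  agree, and distinctness of the list then forces the permutation to be the identity.\<close>

lemma eta_hat_component: "eta_hat $ I $ J = (if I = J then of_real (\<Prod>i\<in>I. eta i i) else 0)"
proof (cases "card I = card J")
  case False
  then show ?thesis by (auto simp: eta_hat_def)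
next
  case card: True
  define k where "k = card I"
  define xs where "xs = sorted_list_of_set I"
  define ys where "ys = sorted_list_of_set J"
  have xs: "length xs = k" "set xs = I" "distinct xs"
    and ys: "length ys = k" "set ys = J" "distinct ys"
    using card by (simp_all add: k_def xs_def ys_def)
  have "det_nat k (\<lambda>i j. eta (xs ! i) (ys ! j)) = (if I = J then \<Prod>i\<in>I. eta i i else 0)"
  proof (cases "I = J")
    case False
    have "(\<Prod>i<k. eta (xs ! i) (ys ! p i)) = 0" if p: "p permutes {..<k}" for p
    proof -
      \<comment> \<open>If every entry matched, \<open>I\<close> would be contained in
        \<open>J\<close>, and equal cardinality would make them equal.\<close>
      have "\<exists>i<k. xs ! i \<noteq> ys ! p i"
      proof (rule ccontr)
        assume "\<not> ?thesis"
        moreover have "p i < k" if "i < k" for i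
          using permutes_in_image [OF p, of i] that by simp
        ultimately have "I \<subseteq> J"
          using xs ys by (metis (no_types, opaque_lifting) in_set_conv_nth subsetI)
        with card False show False by (simp add: card_subset_eq)
      qed
      then obtain i where "i < k" "eta (xs ! i) (ys ! p i) = 0" by (auto simp: eta_def)
      then show ?thesis by (metis finite_lessThan lessThan_iff prod_zero_iff)
    qed
    with False show ?thesis by (simp add: det_nat_def del: prod_zero_iff)
  next
    case True
    then have [simp]: "ys = xs" by (simp add: xs_def ys_def)
    have "(\<Prod>i<k. eta (xs ! i) (xs ! p i)) = 0" if p: "p permutes {..<k}" "p \<noteq> id" for p
    proof -
      obtain i where i: "p i \<noteq> i" using p(2) by (auto simp: fun_eq_iff)
      then have "i < k" using p(1) by (metis lessThan_iff permutes_not_in)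
      moreover have "p i < k" using permutes_in_image [OF p(1), of i] \<open>i < k\<close> by simp
      ultimately have "xs ! i \<noteq> xs ! p i" using xs i by (simp add: nth_eq_iff_index_eq)
      then have "eta (xs ! i) (xs ! p i) = 0" by (simp add: eta_def)
      with \<open>i < k\<close> show ?thesis by (metis finite_lessThan lessThan_iff prod_zero_iff)
    qed
    then have "det_nat k (\<lambda>i j. eta (xs ! i) (ys ! j))
      = (\<Sum>p | p permutes {..<k}. if p = id then \<Prod>i<k. eta (xs ! i) (xs ! i) else 0)"
      unfolding det_nat_def by (intro sum.cong refl) (auto simp: sign_id)
    also have "\<dots> = (\<Prod>i<k. eta (xs ! i) (xs ! i))"
      by (simp add: finite_permutations permutes_id)
    also have "\<dots> = (\<Prod>i\<in>I. eta i i)"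
      by (rule prod.reindex_bij_betw) (rule bij_betw_nth [OF xs(3)]; simp add: xs)
    finally show ?thesis using True by simp
  qed
  then show ?thesis using card by (simp add: eta_hat_def k_def xs_def ys_def)
qed

definition eta_diag :: "4 set \<Rightarrow> complex" where
  "eta_diag I = of_real (\<Prod>i\<in>I. eta i i)"

lemma eta_diag_insert: "a \<notin> I \<Longrightarrow> eta_diag (insert a I) = eta a a * eta_diag I"
  by (simp add: eta_diag_def)

lemma eta_diag_sq: "eta_diag I * eta_diag I = 1"
  by (simp add: eta_diag_def prod.distrib [symmetric] flip: of_real_mult)

lemma cnj_eta_diag [simp]: "cnj (eta_diag I) = eta_diag I"
  by (simp add: eta_diag_def)

lemma eta_form_eq: "eta_form \<phi> \<psi> = (\<Sum>I\<in>UNIV. cnj (\<phi> $ I) * eta_diag I * \<psi> $ I)"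
proof -
  have "(eta_hat *v \<psi>) $ I = eta_diag I * \<psi> $ I" for I
    by (simp add: matrix_vector_mult_def eta_hat_component eta_diag_def if_distribR if_distrib cong: if_cong)
  then show ?thesis by (simp add: eta_form_def mult_ac)
qed

lemma cnj_eta_form: "cnj (eta_form \<phi> \<psi>) = eta_form \<psi> \<phi>"
  by (simp add: eta_form_eq mult_ac)

text \<open>With H the diagonal matrix of \<open>eta_diag\<close>, the hypothesis is the entrywise
  form of H B = C' H, where C' is the conjugate transpose of C.\<close>

lemma eta_form_adjointI:
  assumes "\<And>I K. eta_diag I * B $ I $ K = cnj (C $ K $ I) * eta_diag K"
  shows "eta_form \<phi> (B *v \<psi>) = eta_form (C *v \<phi>) \<psi>"
proof -
  have "eta_form \<phi> (B *v \<psi>) = (\<Sum>I\<in>UNIV. \<Sum>K\<in>UNIV. cnj (\<phi> $ I) * \<psi> $ K * (eta_diag I * B $ I $ K))"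
    by (simp add: eta_form_eq matrix_vector_mult_def sum_distrib_left mult_ac)
  also have "\<dots> = (\<Sum>K\<in>UNIV. \<Sum>I\<in>UNIV. cnj (\<phi> $ I) * \<psi> $ K * (cnj (C $ K $ I) * eta_diag K))"
    by (subst sum.swap) (simp add: assms)
  also have "\<dots> = eta_form (C *v \<phi>) \<psi>"
    by (simp add: eta_form_eq matrix_vector_mult_def sum_distrib_left sum_distrib_right mult_ac)
  finally show ?thesis .
qed

text \<open>An entry of \<open>gamma \<alpha>\<close> is nonzero only between sets that differ by
  exactly \<alpha>. Removal carries an extra factor \<open>- eta \<alpha> \<alpha>\<close> compared
  with insertion; the metric factor is absorbed by the ratio of the two diagonal entries of the
  form, and the minus sign remains.\<close>

lemma eta_form_gamma: "eta_form \<phi> (gamma \<alpha> *v \<psi>) = - eta_form (gamma \<alpha> *v \<phi>) \<psi>"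
proof -
  have "eta_form \<phi> (gamma \<alpha> *v \<psi>) = eta_form (- gamma \<alpha> *v \<phi>) \<psi>"
  proof (rule eta_form_adjointI)
    fix I K :: "4 set"
    show "eta_diag I * gamma \<alpha> $ I $ K = cnj ((- gamma \<alpha>) $ K $ I) * eta_diag K"
    proof (cases "\<alpha> \<in> K")
      case True
      then obtain K' where "\<alpha> \<notin> K'" "K = insert \<alpha> K'" by (metis mk_disjoint_insert)
      then show ?thesis by (auto simp: gamma_component eta_diag_insert mult_ac)
    next
      case False
      show ?thesis
      proof (cases "\<alpha> \<in> I")
        case True
        then obtain I' where "\<alpha> \<notin> I'" "I = insert \<alpha> I'" by (metis mk_disjoint_insert)
        with False show ?thesis by (auto simp: gamma_component eta_diag_insert mult_ac)
      next
        case False2: False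
        with False show ?thesis by (auto simp: gamma_component)
      qed
    qed
  qed
  also have "\<dots> = - eta_form (gamma \<alpha> *v \<phi>) \<psi>"
    by (simp add: eta_form_eq matrix_vector_mult_def sum_negf)
  finally show ?thesis .
qed

text \<open>Over complementary index sets \<open>eta_diag\<close> multiplies to the determinant of
  \<open>eta\<close>, and \<open>hodge_sign\<close> to the sign of J squared. Both are -1, and since
  all these signs square to 1 the ratios agree.\<close>

lemma eta_form_JJ: "eta_form \<phi> (JJ *v \<psi>) = eta_form (JJ *v \<phi>) \<psi>"
proof (rule eta_form_adjointI)
  fix I K :: "4 set"
  have "eta_diag I * hodge_sign (- I) = hodge_sign I * eta_diag (- I)"
  proof -
    have sq: "hodge_sign I * hodge_sign I = 1" for I
      by (simp add: hodge_sign_def prod.distrib [symmetric] mult_ac)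
    have "eta_diag I * eta_diag (- I) = eta_diag UNIV"
      unfolding eta_diag_def of_real_mult [symmetric]
      by (subst prod.union_disjoint [symmetric]) auto
    also have "\<dots> = - 1"
      unfolding eta_diag_def UNIV_4_from_0 by (simp add: eta_def)
    finally have "eta_diag I * eta_diag (- I) = hodge_sign I * hodge_sign (- I)"
      by (simp add: hodge_sign_Compl)
    with sq [of I] eta_diag_sq [of I] show ?thesis by algebra
  qed
  moreover have "cnj (hodge_sign I) = hodge_sign I" for I
    by (simp add: hodge_sign_def)
  ultimately show "eta_diag I * JJ $ I $ K = cnj (JJ $ K $ I) * eta_diag K"
    by (auto simp: JJ_eq hodge_def)
qed

section \<open>The exponential of J\<close>

definition cplx_op :: "complex \<Rightarrow> operator" where
  "cplx_op z = Re z *\<^sub>R mat 1 + Im z *\<^sub>R JJ"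

lemma bounded_linear_cplx_op: "bounded_linear cplx_op"
  unfolding cplx_op_def [abs_def]
  by (rule bounded_linear_add; rule bounded_linear_compose [OF bounded_linear_scaleR_left])
    (rule bounded_linear_Re bounded_linear_Im)+

lemma operator_add_rdistrib: "(B + C) ** D = B ** D + C ** D" for B C D :: operator
  by (simp add: vec_eq_iff matrix_matrix_mult_def sum.distrib algebra_simps)

text \<open>As \<^const>\<open>JJ\<close> squares to -1, \<^const>\<open>cplx_op\<close> is an embedding of the complex numbers.\<close>

lemma cplx_op_mult: "cplx_op z ** cplx_op w = cplx_op (z * w)"
  by (simp add: cplx_op_def matrix_add_ldistrib operator_add_rdistrib scalar_matrix_assoc [symmetric] matrix_scalar_ac JJ_sq algebra_simps)

text \<open>The exponential series of zeta J is the image of the complex series for exp(i zeta)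
  under the bounded linear and multiplicative map \<open>cplx_op\<close>, so the sum can be taken
  before the map is applied.\<close>

lemma expJ_eq: "expJ \<zeta> = cplx_op (cis \<zeta>)"
proof -
  have *: "cplx_op 1 = mat 1" "\<zeta> *\<^sub>R JJ = cplx_op (\<i> * \<zeta>)"
    by (simp_all add: cplx_op_def)
  have "mat_power (\<zeta> *\<^sub>R JJ) n = cplx_op ((\<i> * \<zeta>) ^ n)" for n
    by (induction n) (simp_all add: cplx_op_mult * del: scaleR_conv_of_real)
  then have "mat_exp (\<zeta> *\<^sub>R JJ) = (\<Sum>n. cplx_op ((\<i> * \<zeta>) ^ n /\<^sub>R fact n))"
    by (simp add: mat_exp_def linear_simps(5) [OF bounded_linear_cplx_op] inverse_eq_divide)
  also have "\<dots> = cplx_op (exp (\<i> * \<zeta>))"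
    using bounded_linear.sums [OF bounded_linear_cplx_op exp_converges] by (rule sums_unique [symmetric])
  finally show ?thesis by (simp add: expJ_def cis_conv_exp)
qed

lemma trace_scaleR: "trace (r *\<^sub>R B) = r *\<^sub>R trace B" for B :: operator
  by (simp add: trace_def scaleR_sum_right)

lemma trace_expJ_sq: "trace (expJ \<zeta> ** expJ \<zeta>) = of_real (16 * cos (2 * \<zeta>))"
proof -
  have "trace (expJ \<zeta> ** expJ \<zeta>) = cos (2 * \<zeta>) *\<^sub>R 16"
    by (simp add: expJ_eq cplx_op_mult cis_mult)
      (simp add: cplx_op_def trace_add trace_scaleR trace_mat_1 trace_JJ)
  then show ?thesis by (simp add: scaleR_conv_of_real)
qed

lemma expJ_commute: "expJ \<zeta> ** gamma \<alpha> = gamma \<alpha> ** expJ \<zeta>"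
  by (simp add: expJ_eq cplx_op_def matrix_add_ldistrib operator_add_rdistrib scalar_matrix_assoc [symmetric] matrix_scalar_ac
      JJ_eq hodge_commute)

lemma eta_form_add_left: "eta_form (\<phi> + \<phi>') \<psi> = eta_form \<phi> \<psi> + eta_form \<phi>' \<psi>"
  by (simp add: eta_form_eq sum.distrib algebra_simps)

lemma eta_form_add_right: "eta_form \<phi> (\<psi> + \<psi>') = eta_form \<phi> \<psi> + eta_form \<phi> \<psi>'"
  by (simp add: eta_form_eq sum.distrib algebra_simps)

lemma eta_form_scaleR: "eta_form (r *\<^sub>R \<phi>) \<psi> = r * eta_form \<phi> \<psi>" "eta_form \<phi> (r *\<^sub>R \<psi>) = r * eta_form \<phi> \<psi>"
  by (simp_all add: eta_form_eq sum_distrib_left mult_ac)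
    (simp_all add: scaleR_conv_of_real mult_ac)

lemma eta_form_scale_right: "eta_form \<phi> (c *s \<psi>) = c * eta_form \<phi> \<psi>"
  by (simp add: eta_form_eq sum_distrib_left mult_ac)

lemma scaleR_matrix_vector_mult: "(r *\<^sub>R B) *v x = r *\<^sub>R (B *v x)" for B :: operator
  by (simp add: vec_eq_iff matrix_vector_mult_def scaleR_sum_right)

lemma eta_form_expJ: "eta_form \<phi> (expJ \<zeta> *v \<psi>) = eta_form (expJ \<zeta> *v \<phi>) \<psi>"
  by (simp add: expJ_eq cplx_op_def matrix_vector_mult_add_rdistrib scaleR_matrix_vector_mult
      eta_form_add_left eta_form_add_right eta_form_scaleR eta_form_JJ)

text \<open>Moving the gamma matrix and the exponential across the form costs one sign; as the two
  commute, the same vector reappears in the first argument, and the hermitian symmetry of the form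
  turns this into a conjugate.\<close>

lemma cnj_current:
  "cnj (eta_form \<psi> (gamma \<alpha> *v (expJ \<zeta> *v \<psi>))) = - eta_form \<psi> (gamma \<alpha> *v (expJ \<zeta> *v \<psi>))"
proof -
  have "eta_form \<psi> (gamma \<alpha> *v (expJ \<zeta> *v \<psi>)) = - eta_form (expJ \<zeta> *v (gamma \<alpha> *v \<psi>)) \<psi>"
    by (simp add: eta_form_gamma eta_form_expJ)
  also have "expJ \<zeta> *v (gamma \<alpha> *v \<psi>) = gamma \<alpha> *v (expJ \<zeta> *v \<psi>)"
    by (simp add: matrix_vector_mul_assoc expJ_commute)
  finally show ?thesis by (simp add: cnj_eta_form)
qed

section \<open>Partial derivatives\<close>

lemma pd_eqI: "(f has_derivative f') (at x) \<Longrightarrow> pd \<alpha> f x = f' (axis \<alpha> 1)"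
  by (simp add: pd_def frechet_derivative_at [symmetric])

lemma pd_const [simp]: "pd \<alpha> (\<lambda>x. c) x = 0"
  by (rule pd_eqI [OF has_derivative_const])

lemma has_derivative_pd:
  assumes "f differentiable (at x)"
  obtains f' where "(f has_derivative f') (at x)" "\<And>\<alpha>. pd \<alpha> f x = f' (axis \<alpha> 1)"
  using assms pd_eqI unfolding differentiable_def by blast

lemma pd_bounded_linear:
  assumes "bounded_linear g" "f differentiable (at x)"
  shows "pd \<alpha> (\<lambda>y. g (f y)) x = g (pd \<alpha> f x)"
  using assms(2) by (rule has_derivative_pd) (simp add: pd_eqI [OF bounded_linear.has_derivative [OF assms(1)]])

lemma differentiable_bounded_linear:
  assumes "bounded_linear g" "f differentiable (at x)"
  shows "(\<lambda>y. g (f y)) differentiable (at x)"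
  using assms bounded_linear.has_derivative unfolding differentiable_def by blast

lemma pd_add:
  assumes "f differentiable (at x)" "g differentiable (at x)"
  shows "pd \<alpha> (\<lambda>y. f y + g y) x = pd \<alpha> f x + pd \<alpha> g x"
  using assms(1) assms(2)
  by (elim has_derivative_pd) (simp add: pd_eqI [OF has_derivative_add])

lemma pd_diff:
  assumes "f differentiable (at x)" "g differentiable (at x)"
  shows "pd \<alpha> (\<lambda>y. f y - g y) x = pd \<alpha> f x - pd \<alpha> g x"
  using assms(1) assms(2)
  by (elim has_derivative_pd) (simp add: pd_eqI [OF has_derivative_diff])

lemma pd_sum:
  assumes "\<And>i. i \<in> S \<Longrightarrow> f i differentiable (at x)"
  shows "pd \<alpha> (\<lambda>y. \<Sum>i\<in>S. f i y) x = (\<Sum>i\<in>S. pd \<alpha> (f i) x)"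
proof -
  have "\<exists>f'. (f i has_derivative f') (at x)" if "i \<in> S" for i
    using assms [OF that] by (simp add: differentiable_def)
  then obtain f' where f': "\<And>i. i \<in> S \<Longrightarrow> (f i has_derivative f' i) (at x)" by metis
  show ?thesis
    by (subst pd_eqI [OF has_derivative_sum [OF f']]) (auto simp: pd_eqI [OF f'])
qed

lemma pd_scaleR:
  fixes f :: "real^4 \<Rightarrow> real" and g :: "real^4 \<Rightarrow> 'b::real_normed_vector"
  assumes "f differentiable (at x)" "g differentiable (at x)"
  shows "pd \<alpha> (\<lambda>y. f y *\<^sub>R g y) x = f x *\<^sub>R pd \<alpha> g x + pd \<alpha> f x *\<^sub>R g x"
  using assms(1) assms(2)
  by (elim has_derivative_pd) (simp add: pd_eqI [OF has_derivative_scaleR])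

section \<open>Smooth functions\<close>

text \<open>The product rule leaves undifferentiated factors behind, and the induction for products
  uses these one order lower.\<close>

lemma times_cont_diff_mono: "times_cont_diff (Suc k) f \<Longrightarrow> times_cont_diff k f"
proof (induction k arbitrary: f)
  case 0
  then show ?case
    by (simp add: continuous_on_eq_continuous_within differentiable_imp_continuous_within)
next
  case (Suc k)
  then show ?case by auto
qed

lemma times_cont_diff_const [simp]: "times_cont_diff k (\<lambda>x. c)"
proof -
  have [simp]: "pd \<alpha> (\<lambda>x. c) = (\<lambda>x. 0)" for \<alpha> and c :: 'a by (rule ext) simp
  show ?thesis by (induction k arbitrary: c) simp_all
qed

lemma times_cont_diff_bounded_linear:
  assumes g: "bounded_linear g"
  shows "times_cont_diff k f \<Longrightarrow> times_cont_diff k (\<lambda>x. g (f x))"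
proof (induction k arbitrary: f)
  case 0
  then show ?case by (simp add: bounded_linear.continuous_on [OF g])
next
  case (Suc k)
  have "pd \<alpha> (\<lambda>x. g (f x)) = (\<lambda>x. g (pd \<alpha> f x))" for \<alpha>
    using Suc.prems by (intro ext pd_bounded_linear [OF g]) auto
  then show ?case using Suc by (simp add: differentiable_bounded_linear [OF g])
qed

lemma times_cont_diff_add:
  "times_cont_diff k f \<Longrightarrow> times_cont_diff k g \<Longrightarrow> times_cont_diff k (\<lambda>x. f x + g x)"
proof (induction k arbitrary: f g)
  case 0
  then show ?case by (simp add: continuous_on_add)
next
  case (Suc k)
  have "pd \<alpha> (\<lambda>x. f x + g x) = (\<lambda>x. pd \<alpha> f x + pd \<alpha> g x)" for \<alpha>
    using Suc.prems by (intro ext pd_add) auto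
  then show ?case using Suc by simp
qed

lemma times_cont_diff_scaleR:
  fixes f :: "real^4 \<Rightarrow> real" and g :: "real^4 \<Rightarrow> 'b::real_normed_vector"
  shows "times_cont_diff k f \<Longrightarrow> times_cont_diff k g \<Longrightarrow> times_cont_diff k (\<lambda>x. f x *\<^sub>R g x)"
proof (induction k arbitrary: f g)
  case 0
  then show ?case by (simp add: continuous_on_scaleR)
next
  case (Suc k)
  have "pd \<alpha> (\<lambda>x. f x *\<^sub>R g x) = (\<lambda>x. f x *\<^sub>R pd \<alpha> g x + pd \<alpha> f x *\<^sub>R g x)" for \<alpha>
    using Suc.prems by (intro ext pd_scaleR) auto
  then show ?case
    using Suc times_cont_diff_mono [OF Suc.prems(1)] times_cont_diff_mono [OF Suc.prems(2)]
    by (simp add: times_cont_diff_add differentiable_scaleR)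
qed

lemma times_cont_diff_id [simp]: "times_cont_diff k (\<lambda>x. x)"
proof (cases k)
  case (Suc l)
  have "pd \<alpha> (\<lambda>x. x) = (\<lambda>x. axis \<alpha> 1)" for \<alpha>
    by (rule ext, rule pd_eqI [OF has_derivative_ident])
  with Suc show ?thesis by simp
qed simp

lemma smooth_const [simp]: "smooth (\<lambda>x. c)"
  by (simp add: smooth_def)

lemma smooth_id [simp]: "smooth (\<lambda>x. x)"
  by (simp add: smooth_def)

lemma smooth_bounded_linear: "bounded_linear g \<Longrightarrow> smooth f \<Longrightarrow> smooth (\<lambda>x. g (f x))"
  by (simp add: smooth_def times_cont_diff_bounded_linear)

lemma smooth_add: "smooth f \<Longrightarrow> smooth g \<Longrightarrow> smooth (\<lambda>x. f x + g x)"
  by (simp add: smooth_def times_cont_diff_add)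

lemma smooth_scaleR: "smooth f \<Longrightarrow> smooth g \<Longrightarrow> smooth (\<lambda>x. f x *\<^sub>R g x)"
  by (simp add: smooth_def times_cont_diff_scaleR)

lemma smooth_mult: "smooth f \<Longrightarrow> smooth g \<Longrightarrow> smooth (\<lambda>x. f x * g x)" for f g :: "_ \<Rightarrow> real"
  using smooth_scaleR [of f g] by simp

lemma smooth_diff:
  assumes "smooth f" "smooth g"
  shows "smooth (\<lambda>x. f x - g x)"
  using smooth_add [OF assms(1) smooth_scaleR [OF smooth_const [of "-1"] assms(2)]] by simp

lemma smooth_component: "smooth f \<Longrightarrow> smooth (\<lambda>x. f x $ i)"
  for f :: "real^4 \<Rightarrow> 'b::real_normed_vector ^ 'n"
  by (rule smooth_bounded_linear [OF bounded_linear_vec_nth])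

lemma smooth_sum: "(\<And>i. i \<in> S \<Longrightarrow> smooth (f i)) \<Longrightarrow> smooth (\<lambda>x. \<Sum>i\<in>S. f i x)"
  by (induction S rule: infinite_finite_induct) (simp_all add: smooth_add)

lemma smooth_pd: "smooth f \<Longrightarrow> smooth (pd \<alpha> f)"
  unfolding smooth_def by (metis times_cont_diff.simps(2))

lemma smooth_differentiable: "smooth f \<Longrightarrow> f differentiable (at x)"
  unfolding smooth_def by (metis times_cont_diff.simps(2))

lemma smooth_continuous: "smooth f \<Longrightarrow> continuous_on S f"
  unfolding smooth_def by (metis times_cont_diff.simps(1) continuous_on_subset subset_UNIV)

section \<open>Symmetry of second derivatives\<close>

lemma has_real_derivative_pd:
  fixes f :: "real^4 \<Rightarrow> real"
  assumes "f differentiable (at (x + t *\<^sub>R axis \<alpha> 1))"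
  shows "((\<lambda>t. f (x + t *\<^sub>R axis \<alpha> 1)) has_real_derivative pd \<alpha> f (x + t *\<^sub>R axis \<alpha> 1)) (at t)"
proof -
  obtain f' where f': "(f has_derivative f') (at (x + t *\<^sub>R axis \<alpha> 1))"
    and pd: "\<And>\<beta>. pd \<beta> f (x + t *\<^sub>R axis \<alpha> 1) = f' (axis \<beta> 1)"
    using has_derivative_pd [OF assms] by metis
  have "((\<lambda>t. x + t *\<^sub>R axis \<alpha> 1) has_derivative (\<lambda>h. h *\<^sub>R axis \<alpha> 1)) (at t)"
    by (auto intro!: derivative_eq_intros)
  from has_derivative_compose [OF this f']
  show ?thesis
    by (rule has_derivative_imp_has_field_derivative)
      (simp add: pd linear_simps(5) [OF has_derivative_bounded_linear [OF f']])
qed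

text \<open>The mean value theorem is applied in direction \<beta> to the increment of f in
  direction \<alpha>, then in direction \<alpha> to \<open>pd \<beta> f\<close>. Since both steps
  have the same length r, the left side is symmetric in \<alpha> and \<beta>, so it can be evaluated
  in either order.\<close>

lemma second_difference:
  fixes f :: "real^4 \<Rightarrow> real"
  assumes "\<And>x. f differentiable (at x)" "\<And>x. pd \<beta> f differentiable (at x)" and "r > 0"
  obtains s t where "0 < s" "s < r" "0 < t" "t < r"
    "f (x + r *\<^sub>R axis \<alpha> 1 + r *\<^sub>R axis \<beta> 1) - f (x + r *\<^sub>R axis \<alpha> 1) - f (x + r *\<^sub>R axis \<beta> 1) + f x
      = r\<^sup>2 * pd \<alpha> (pd \<beta> f) (x + t *\<^sub>R axis \<beta> 1 + s *\<^sub>R axis \<alpha> 1)"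
proof -
  let ?a = "axis \<alpha> 1 :: real^4" and ?b = "axis \<beta> 1 :: real^4"
  define g where "g t = f (x + r *\<^sub>R ?a + t *\<^sub>R ?b) - f (x + t *\<^sub>R ?b)" for t
  have "(g has_real_derivative pd \<beta> f (x + r *\<^sub>R ?a + t *\<^sub>R ?b) - pd \<beta> f (x + t *\<^sub>R ?b)) (at t)" for t
    unfolding g_def by (intro DERIV_diff has_real_derivative_pd assms)
  then obtain t where t: "0 < t" "t < r"
    "g r - g 0 = r * (pd \<beta> f (x + r *\<^sub>R ?a + t *\<^sub>R ?b) - pd \<beta> f (x + t *\<^sub>R ?b))"
    using MVT2 [OF \<open>r > 0\<close>, of g "\<lambda>t. pd \<beta> f (x + r *\<^sub>R ?a + t *\<^sub>R ?b) - pd \<beta> f (x + t *\<^sub>R ?b)"] by auto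
  have "((\<lambda>s. pd \<beta> f (x + t *\<^sub>R ?b + s *\<^sub>R ?a)) has_real_derivative
      pd \<alpha> (pd \<beta> f) (x + t *\<^sub>R ?b + s *\<^sub>R ?a)) (at s)" for s
    by (intro has_real_derivative_pd assms)
  then obtain s where s: "0 < s" "s < r"
    "pd \<beta> f (x + t *\<^sub>R ?b + r *\<^sub>R ?a) - pd \<beta> f (x + t *\<^sub>R ?b + 0 *\<^sub>R ?a)
      = r * pd \<alpha> (pd \<beta> f) (x + t *\<^sub>R ?b + s *\<^sub>R ?a)"
    using MVT2 [OF \<open>r > 0\<close>, of "\<lambda>s. pd \<beta> f (x + t *\<^sub>R ?b + s *\<^sub>R ?a)"
        "\<lambda>s. pd \<alpha> (pd \<beta> f) (x + t *\<^sub>R ?b + s *\<^sub>R ?a)"] by auto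
  have "f (x + r *\<^sub>R ?a + r *\<^sub>R ?b) - f (x + r *\<^sub>R ?a) - f (x + r *\<^sub>R ?b) + f x = g r - g 0"
    by (simp add: g_def)
  also have "\<dots> = r\<^sup>2 * pd \<alpha> (pd \<beta> f) (x + t *\<^sub>R ?b + s *\<^sub>R ?a)"
    using s(3) by (simp add: t(3) power2_eq_square algebra_simps)
  finally show thesis using that s t by blast
qed

lemma pd_commute:
  fixes f :: "real^4 \<Rightarrow> real"
  assumes "smooth f"
  shows "pd \<alpha> (pd \<beta> f) x = pd \<beta> (pd \<alpha> f) x"
proof (rule ccontr)
  assume neq: "pd \<alpha> (pd \<beta> f) x \<noteq> pd \<beta> (pd \<alpha> f) x"
  define e where "e = \<bar>pd \<alpha> (pd \<beta> f) x - pd \<beta> (pd \<alpha> f) x\<bar> / 2"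
  have "e > 0" using neq by (simp add: e_def)
  have "\<exists>d>0. \<forall>y. dist y x < d \<longrightarrow> \<bar>pd \<gamma> (pd \<delta> f) y - pd \<gamma> (pd \<delta> f) x\<bar> < e" for \<gamma> \<delta>
    using smooth_continuous [OF smooth_pd [OF smooth_pd [OF assms]], of UNIV \<gamma> \<delta>] \<open>e > 0\<close>
    unfolding continuous_on_iff dist_real_def by auto
  then obtain d1 d2 where d: "d1 > 0" "d2 > 0"
    "\<And>y. dist y x < d1 \<Longrightarrow> \<bar>pd \<alpha> (pd \<beta> f) y - pd \<alpha> (pd \<beta> f) x\<bar> < e"
    "\<And>y. dist y x < d2 \<Longrightarrow> \<bar>pd \<beta> (pd \<alpha> f) y - pd \<beta> (pd \<alpha> f) x\<bar> < e" by metis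
  \<comment> \<open>The intermediate points lie within s + t < 2 r of x, so the halving puts them in
    both continuity neighbourhoods.\<close>
  define r where "r = min d1 d2 / 2"
  have "r > 0" "2 * r \<le> d1" "2 * r \<le> d2" using d by (auto simp: r_def)
  have near: "dist (x + t *\<^sub>R axis \<gamma> 1 + s *\<^sub>R axis \<delta> 1) x < 2 * r"
    if "0 < s" "s < r" "0 < t" "t < r" for s t \<gamma> \<delta>
  proof -
    have "norm (t *\<^sub>R axis \<gamma> 1 + s *\<^sub>R axis \<delta> 1 :: real^4) \<le> t + s"
      using norm_triangle_ineq [of "t *\<^sub>R axis \<gamma> 1 :: real^4" "s *\<^sub>R axis \<delta> 1"] that by simp
    then show ?thesis using that by (simp add: dist_norm add.assoc)
  qed
  obtain s t where st: "0 < s" "s < r" "0 < t" "t < r"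
    "f (x + r *\<^sub>R axis \<alpha> 1 + r *\<^sub>R axis \<beta> 1) - f (x + r *\<^sub>R axis \<alpha> 1) - f (x + r *\<^sub>R axis \<beta> 1) + f x
      = r\<^sup>2 * pd \<alpha> (pd \<beta> f) (x + t *\<^sub>R axis \<beta> 1 + s *\<^sub>R axis \<alpha> 1)"
    using second_difference [of f \<beta> r x \<alpha>] assms smooth_pd smooth_differentiable \<open>r > 0\<close> by metis
  obtain s' t' where st': "0 < s'" "s' < r" "0 < t'" "t' < r"
    "f (x + r *\<^sub>R axis \<beta> 1 + r *\<^sub>R axis \<alpha> 1) - f (x + r *\<^sub>R axis \<beta> 1) - f (x + r *\<^sub>R axis \<alpha> 1) + f x
      = r\<^sup>2 * pd \<beta> (pd \<alpha> f) (x + t' *\<^sub>R axis \<alpha> 1 + s' *\<^sub>R axis \<beta> 1)"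
    using second_difference [of f \<alpha> r x \<beta>] assms smooth_pd smooth_differentiable \<open>r > 0\<close> by metis
  have "r\<^sup>2 * pd \<alpha> (pd \<beta> f) (x + t *\<^sub>R axis \<beta> 1 + s *\<^sub>R axis \<alpha> 1)
    = r\<^sup>2 * pd \<beta> (pd \<alpha> f) (x + t' *\<^sub>R axis \<alpha> 1 + s' *\<^sub>R axis \<beta> 1)"
    using st(5) st'(5) by (simp add: algebra_simps)
  then have "pd \<alpha> (pd \<beta> f) (x + t *\<^sub>R axis \<beta> 1 + s *\<^sub>R axis \<alpha> 1)
    = pd \<beta> (pd \<alpha> f) (x + t' *\<^sub>R axis \<alpha> 1 + s' *\<^sub>R axis \<beta> 1)"
    using \<open>r > 0\<close> by simp
  moreover have "\<bar>pd \<alpha> (pd \<beta> f) (x + t *\<^sub>R axis \<beta> 1 + s *\<^sub>R axis \<alpha> 1) - pd \<alpha> (pd \<beta> f) x\<bar> < e"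
    using near [OF st(1-4), of \<beta> \<alpha>] \<open>2 * r \<le> d1\<close> by (intro d(3)) linarith
  moreover have "\<bar>pd \<beta> (pd \<alpha> f) (x + t' *\<^sub>R axis \<alpha> 1 + s' *\<^sub>R axis \<beta> 1) - pd \<beta> (pd \<alpha> f) x\<bar> < e"
    using near [OF st'(1-4), of \<alpha> \<beta>] \<open>2 * r \<le> d2\<close> by (intro d(4)) linarith
  \<comment> \<open>P is the common value of the two mixed derivatives at their intermediate points;
    it cannot be closer than half the gap to both p and q.\<close>
  moreover have "\<not> (\<bar>P - p\<bar> < \<bar>p - q\<bar> / 2 \<and> \<bar>P - q\<bar> < \<bar>p - q\<bar> / 2)" for P p q :: real
    using abs_triangle_ineq4 [of "P - q" "P - p"] by auto
  ultimately show False unfolding e_def by metis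
qed

section \<open>Integration by parts\<close>

lemma set_integrable_continuous:
  fixes f :: "real^4 \<Rightarrow> 'b::{banach, second_countable_topology}"
  assumes "continuous_on UNIV f" "compact K"
  shows "set_integrable lborel K f"
  unfolding set_integrable_def
  using assms by (intro borel_integrable_compact) (auto intro: continuous_on_subset)

lemma set_integral_superset:
  fixes f :: "'a \<Rightarrow> 'b::{banach, second_countable_topology}"
  assumes "K \<subseteq> L" "\<And>x. x \<notin> K \<Longrightarrow> f x = 0"
  shows "(LINT x:L|M. f x) = (LINT x:K|M. f x)"
  unfolding set_lebesgue_integral_def
  using assms by (intro Bochner_Integration.integral_cong) (auto simp: indicator_def)

lemma set_integrable_sum:
  fixes f :: "'i \<Rightarrow> 'a \<Rightarrow> real"
  assumes "\<And>i. i \<in> S \<Longrightarrow> set_integrable M K (f i)"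
  shows "set_integrable M K (\<lambda>x. \<Sum>i\<in>S. f i x)"
  using assms unfolding set_integrable_def scaleR_sum_right by (rule Bochner_Integration.integrable_sum)

lemma set_integral_sum:
  fixes f :: "'i \<Rightarrow> 'a \<Rightarrow> real"
  assumes "\<And>i. i \<in> S \<Longrightarrow> set_integrable M K (f i)"
  shows "(LINT x:K|M. \<Sum>i\<in>S. f i x) = (\<Sum>i\<in>S. LINT x:K|M. f i x)"
  using assms unfolding set_integrable_def set_lebesgue_integral_def scaleR_sum_right
  by (rule Bochner_Integration.integral_sum)

text \<open>By translation invariance, the integral of \<open>f (x + t *\<^sub>R axis \<alpha> 1)\<close> does not depend on t.\<close>

lemma integral_pd_eq_0:
  fixes f :: "real^4 \<Rightarrow> real"
  assumes "smooth f" "compact K" and zero: "\<And>x. x \<notin> K \<Longrightarrow> f x = 0"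
  shows "(LINT x:K|lborel. pd \<alpha> f x) = 0"
proof -
  let ?e = "axis \<alpha> 1 :: real^4"
  \<comment> \<open>K is closed, so f vanishes on a whole neighbourhood of such a point.\<close>
  have pd0: "pd \<alpha> f x = 0" if "x \<notin> K" for x
  proof -
    have "(f has_derivative (\<lambda>h. 0)) (at x)"
      by (rule has_derivative_transform_within_open [OF has_derivative_const [of 0], where s = "- K"])
        (use that zero compact_imp_closed [OF \<open>compact K\<close>] in auto)
    then show ?thesis by (rule pd_eqI)
  qed
  obtain B where B: "\<And>x. x \<in> K \<Longrightarrow> norm x \<le> B"
    using compact_imp_bounded [OF \<open>compact K\<close>] by (auto simp: bounded_iff)
  \<comment> \<open>The margin 1 keeps the support inside one fixed box for all shifts with |t| < 1,
    so the domain of integration does not move with t.\<close>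
  obtain a where a: "cball 0 (B + 1) \<subseteq> cbox (- a) (a :: real^4)"
    using bounded_subset_cbox_symmetric [OF bounded_cball] by metis
  have K: "K \<subseteq> cbox (- a) a"
    using B a by (force simp: subset_iff)
  note cont = smooth_continuous [OF \<open>smooth f\<close>] smooth_continuous [OF smooth_pd [OF \<open>smooth f\<close>]]
  define g where "g t = integral (cbox (- a) a) (\<lambda>x. f (x + t *\<^sub>R ?e))" for t
  have shift: "continuous_on S (\<lambda>x. f (x + t *\<^sub>R ?e))" for S t
    by (intro continuous_on_compose2 [OF cont(1)] continuous_intros) auto
  have g: "g t = (LINT x|lborel. f x)" if "t \<in> {-1<..<1}" for t
  proof -
    have "x \<in> cbox (- a) a" if "f (x + t *\<^sub>R ?e) \<noteq> 0" for x
    proof -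
      have "norm (x + t *\<^sub>R ?e) \<le> B" using that zero B by blast
      moreover have "norm x \<le> norm (x + t *\<^sub>R ?e) + norm (t *\<^sub>R ?e)"
        using norm_triangle_ineq4 [of "x + t *\<^sub>R ?e" "t *\<^sub>R ?e"] by simp
      ultimately have "norm x \<le> B + 1" using \<open>t \<in> {-1<..<1}\<close> by auto
      then show ?thesis using a by auto
    qed
    then have "(LINT x|lborel. f (x + t *\<^sub>R ?e)) = (LINT x:cbox (- a) a|lborel. f (x + t *\<^sub>R ?e))"
      unfolding set_lebesgue_integral_def by (intro Bochner_Integration.integral_cong) (auto simp: indicator_def)
    also have "\<dots> = g t"
      unfolding g_def by (intro set_borel_integral_eq_integral set_integrable_continuous shift compact_cbox)
    finally have "g t = (LINT x|lborel. f (t *\<^sub>R ?e + x))" by (simp add: add.commute)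
    also have "\<dots> = (LINT x|distr lborel borel ((+) (t *\<^sub>R ?e)). f x)"
      by (rule integral_distr [symmetric]) (auto intro: borel_measurable_continuous_onI cont)
    finally show ?thesis by (simp add: lborel_distr_plus)
  qed
  have deriv: "(g has_vector_derivative integral (cbox (- a) a) (\<lambda>x. pd \<alpha> f (x + 0 *\<^sub>R ?e)))
      (at 0 within {-1<..<1})"
    unfolding g_def
  proof (rule leibniz_rule_vector_derivative)
    show "((\<lambda>t. f (x + t *\<^sub>R ?e)) has_vector_derivative pd \<alpha> f (x + t *\<^sub>R ?e)) (at t within {-1<..<1})" for x t
      using has_real_derivative_pd [OF smooth_differentiable [OF \<open>smooth f\<close>]]
      by (metis has_real_derivative_iff_has_vector_derivative has_vector_derivative_at_within)
    show "(\<lambda>x. f (x + t *\<^sub>R ?e)) integrable_on cbox (- a) a" for t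
      by (intro integrable_continuous shift)
    show "continuous_on ({-1<..<1} \<times> cbox (- a) a) (\<lambda>(t, x). pd \<alpha> f (x + t *\<^sub>R ?e))"
      unfolding split_beta by (intro continuous_on_compose2 [OF cont(2)] continuous_intros) auto
  qed auto
  \<comment> \<open>Near 0 the function g is constant, so its derivative, found by differentiating
    under the integral sign, must be 0.\<close>
  have "((\<lambda>t. LINT x|lborel. f x) has_vector_derivative integral (cbox (- a) a) (\<lambda>x. pd \<alpha> f (x + 0 *\<^sub>R ?e)))
      (at 0 within {-1<..<1})"
    by (rule has_vector_derivative_transform [OF _ _ deriv]) (auto simp: g)
  then have "((\<lambda>t. LINT x|lborel. f x) has_vector_derivative integral (cbox (- a) a) (pd \<alpha> f)) (at (0::real))"
    by (simp add: at_within_open [of 0 "{-1<..<1::real}"])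
  then have "integral (cbox (- a) a) (pd \<alpha> f) = 0"
    by (rule vector_derivative_unique_at [OF _ has_vector_derivative_const])
  moreover have "(LINT x:K|lborel. pd \<alpha> f x) = (LINT x:cbox (- a) a|lborel. pd \<alpha> f x)"
    by (rule set_integral_superset [OF K, symmetric]) (rule pd0)
  moreover have "\<dots> = integral (cbox (- a) a) (pd \<alpha> f)"
    by (intro set_borel_integral_eq_integral set_integrable_continuous cont compact_cbox)
  ultimately show ?thesis by simp
qed

section \<open>The fundamental lemma of the calculus of variations\<close>

text \<open>This is the standard flat function exp(-1/t), extended by 0, with a polynomial in 1/t in
  front. The polynomial makes the family closed under differentiation, so smoothness follows from
  one induction on the order with \<open>p\<close> arbitrary.\<close>

definition flat_exp :: "real poly \<Rightarrow> real \<Rightarrow> real" where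
  "flat_exp p t = (if t > 0 then poly p (inverse t) * exp (- inverse t) else 0)"

text \<open>The derivative of \<open>p (1 / t) * exp (- 1 / t)\<close> is of the same form, also at the flat point 0.\<close>

definition flat_exp_deriv :: "real poly \<Rightarrow> real poly" where
  "flat_exp_deriv p = [:0, 0, 1:] * (p - pderiv p)"

lemma tendsto_poly_div_exp_0: "((\<lambda>s. poly p s * exp (- s)) \<longlongrightarrow> (0::real)) at_top"
proof -
  have "((\<lambda>s. \<Sum>i\<le>degree p. coeff p i * (s ^ i / exp s)) \<longlongrightarrow> (\<Sum>i\<le>degree p. coeff p i * 0)) at_top"
    by (intro tendsto_intros tendsto_power_div_exp_0)
  then show ?thesis
    by (simp add: poly_altdef sum_distrib_right exp_minus divide_inverse mult.assoc)
qed

text \<open>With s = 1/t one has ds/dt = -s^2, so the derivative of p(s) exp(-s) is s^2 (p - p')(s)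
  exp(-s). Away from 0 this is the chain rule; at 0 the one-sided difference quotients are computed
  separately.\<close>

lemma flat_exp_has_derivative:
  "(flat_exp p has_real_derivative flat_exp (flat_exp_deriv p) t) (at t)"
proof -
  consider "t > 0" | "t < 0" | "t = 0" by linarith
  then show ?thesis
  proof cases
    case 1
    have "((\<lambda>t. poly p (inverse t) * exp (- inverse t)) has_real_derivative
        flat_exp (flat_exp_deriv p) t) (at t)"
      using 1 by (auto intro!: derivative_eq_intros DERIV_chain2 [OF poly_DERIV]
          simp: flat_exp_def flat_exp_deriv_def algebra_simps power2_eq_square)
    then show ?thesis
      by (rule has_field_derivative_transform_within_open [of _ _ _ "{0<..}"]) (use 1 in \<open>auto simp: flat_exp_def\<close>)
  next
    case 2
    have "((\<lambda>t. 0) has_real_derivative flat_exp (flat_exp_deriv p) t) (at t)"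
      using 2 by (simp add: flat_exp_def)
    then show ?thesis
      by (rule has_field_derivative_transform_within_open [of _ _ _ "{..<0}"]) (use 2 in \<open>auto simp: flat_exp_def\<close>)
  next
    case 3
    have "((\<lambda>h. flat_exp p h / h) \<longlongrightarrow> 0) (at_right 0)"
    proof -
      \<comment> \<open>Division by h multiplies the polynomial in 1/h by its variable, and the
        exponential still dominates.\<close>
      have "((\<lambda>h. poly ([:0, 1:] * p) (inverse h) * exp (- inverse h)) \<longlongrightarrow> (0::real)) (at_right 0)"
        by (rule filterlim_compose [OF tendsto_poly_div_exp_0 filterlim_inverse_at_top_right])
      then show ?thesis
        by (rule Lim_transform_eventually)
          (auto simp: flat_exp_def eventually_at_filter divide_inverse)
    qed
    moreover have "((\<lambda>h. flat_exp p h / h) \<longlongrightarrow> 0) (at_left 0)"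
      by (rule Lim_transform_eventually [OF tendsto_const])
        (auto simp: flat_exp_def eventually_at_filter)
    ultimately have "((\<lambda>h. flat_exp p h / h) \<longlongrightarrow> 0) (at 0)"
      by (simp add: filterlim_split_at)
    then show ?thesis using 3 by (simp add: DERIV_def) (simp add: flat_exp_def)
  qed
qed

lemma times_cont_diff_flat_exp:
  assumes "smooth u"
  shows "times_cont_diff k (\<lambda>x. flat_exp p (u x))"
proof (induction k arbitrary: p)
  case 0
  have "isCont (flat_exp p) t" for t
    using flat_exp_has_derivative by (rule DERIV_isCont)
  then have "continuous_on UNIV (flat_exp p)" by (simp add: continuous_at_imp_continuous_on)
  from continuous_on_compose2 [OF this smooth_continuous [OF assms]]
  show ?case by simp
next
  case (Suc k)
  have deriv: "((\<lambda>x. flat_exp p (u x)) has_derivative (\<lambda>h. flat_exp (flat_exp_deriv p) (u x) * u' h)) (at x)"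
    if "(u has_derivative u') (at x)" for x u'
    using has_derivative_compose [OF that has_field_derivative_imp_has_derivative [OF flat_exp_has_derivative]] .
  have "pd \<alpha> (\<lambda>x. flat_exp p (u x)) = (\<lambda>x. flat_exp (flat_exp_deriv p) (u x) *\<^sub>R pd \<alpha> u x)" for \<alpha>
  proof
    fix x
    obtain u' where "(u has_derivative u') (at x)" "\<And>\<alpha>. pd \<alpha> u x = u' (axis \<alpha> 1)"
      using has_derivative_pd [OF smooth_differentiable [OF assms]] by metis
    with pd_eqI [OF deriv [OF this(1)]]
    show "pd \<alpha> (\<lambda>x. flat_exp p (u x)) x = flat_exp (flat_exp_deriv p) (u x) *\<^sub>R pd \<alpha> u x" by simp
  qed
  moreover have "times_cont_diff k (pd \<alpha> u)" for \<alpha>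
    using smooth_pd [OF assms] by (simp add: smooth_def)
  moreover have "(\<lambda>x. flat_exp p (u x)) differentiable (at x)" for x
    using deriv smooth_differentiable [OF assms] unfolding differentiable_def by blast
  ultimately show ?case using times_cont_diff_scaleR [OF Suc, of "pd _ u"] by simp
qed

lemma smooth_bump:
  fixes x0 :: "real^4"
  assumes "r > 0"
  obtains \<phi> :: "real^4 \<Rightarrow> real" where "smooth \<phi>" "\<And>x. \<phi> x \<ge> 0" "\<phi> x0 > 0" "\<And>x. x \<notin> cball x0 r \<Longrightarrow> \<phi> x = 0"
proof -
  \<comment> \<open>The squared distance is written as a sum of coordinate products, so the closure
    rules for smooth functions apply directly.\<close>
  define u where "u x = r\<^sup>2 - (\<Sum>i\<in>UNIV. (x $ i - x0 $ i) * (x $ i - x0 $ i))" for x :: "real^4"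
  have u: "u x = r\<^sup>2 - (norm (x - x0))\<^sup>2" for x
    unfolding u_def norm_vec_def L2_set_def by (simp add: sum_nonneg power2_eq_square)
  have "smooth u"
    unfolding u_def by (intro smooth_diff smooth_const smooth_sum smooth_mult smooth_component smooth_id)
  then have "smooth (\<lambda>x. flat_exp 1 (u x))"
    by (simp add: smooth_def [of "\<lambda>x. flat_exp 1 (u x)"] times_cont_diff_flat_exp)
  moreover have "flat_exp 1 (u x) = 0" if "x \<notin> cball x0 r" for x
  proof -
    have "r < norm (x - x0)" using that by (simp add: dist_norm norm_minus_commute)
    then have "r\<^sup>2 < (norm (x - x0))\<^sup>2" using assms by (intro power_strict_mono) auto
    then show ?thesis by (simp add: flat_exp_def u)
  qed
  moreover have "flat_exp 1 (u x0) > 0" using assms by (simp add: flat_exp_def u)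
  ultimately show thesis using that [of "\<lambda>x. flat_exp 1 (u x)"] by (simp add: flat_exp_def)
qed

text \<open>If w x0 were nonzero, a bump concentrated where w keeps the sign of w x0 would make
  \<open>sgn (w x0) * (\<phi> x * w x)\<close> a nonnegative continuous function with integral 0
  that is positive at x0.\<close>

lemma fundamental_lemma:
  fixes w :: "real^4 \<Rightarrow> real"
  assumes w: "continuous_on UNIV w"
    and zero: "\<And>\<phi> K. smooth \<phi> \<Longrightarrow> compact K \<Longrightarrow> closure {x. \<phi> x \<noteq> 0} \<subseteq> K \<Longrightarrow>
      (LINT x:K|lborel. \<phi> x * w x) = 0"
  shows "w x0 = 0"
proof (rule ccontr)
  assume "w x0 \<noteq> 0"
  have "\<exists>d>0. \<forall>x. dist x x0 < d \<longrightarrow> \<bar>w x - w x0\<bar> < \<bar>w x0\<bar>"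
    using w \<open>w x0 \<noteq> 0\<close> unfolding continuous_on_iff dist_real_def by auto
  then obtain d where d: "d > 0" "\<And>x. dist x x0 < d \<Longrightarrow> \<bar>w x - w x0\<bar> < \<bar>w x0\<bar>" by blast
  \<comment> \<open>The closed ball supporting the bump then fits inside the open ball of radius d,
    where w has the sign of w x0.\<close>
  define r where "r = d / 2"
  have "r > 0" using d by (simp add: r_def)
  obtain \<phi> :: "real^4 \<Rightarrow> real" where \<phi>: "smooth \<phi>" "\<And>x. \<phi> x \<ge> 0" "\<phi> x0 > 0" "\<And>x. x \<notin> cball x0 r \<Longrightarrow> \<phi> x = 0"
    using smooth_bump [OF \<open>r > 0\<close>] by metis
  obtain a where a: "cball x0 r \<subseteq> box (- a) a"
    using bounded_subset_box_symmetric [OF bounded_cball] by metis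
  have "{x. \<phi> x \<noteq> 0} \<subseteq> cball x0 r" using \<phi>(4) by blast
  then have "closure {x. \<phi> x \<noteq> 0} \<subseteq> cball x0 r" by (rule closure_minimal) simp
  then have supp: "closure {x. \<phi> x \<noteq> 0} \<subseteq> cbox (- a) a" using a box_subset_cbox by blast
  let ?f = "\<lambda>x. sgn (w x0) * (\<phi> x * w x)"
  have cont: "continuous_on UNIV (\<lambda>x. \<phi> x * w x)"
    by (intro continuous_on_mult smooth_continuous \<phi> w)
  have int: "set_integrable lborel (cbox (- a) a) (\<lambda>x. \<phi> x * w x)"
    by (intro set_integrable_continuous cont compact_cbox)
  have "((\<lambda>x. \<phi> x * w x) has_integral 0) (cbox (- a) a)"
    using zero [OF \<phi>(1) compact_cbox supp] set_borel_integral_eq_integral [OF int] by (simp add: has_integral_iff)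
  then have "(?f has_integral 0) (cbox (- a) a)"
    using has_integral_mult_right [of _ 0 _ "sgn (w x0)"] by simp
  moreover have "continuous_on (cbox (- a) a) ?f"
    by (intro continuous_on_mult continuous_on_const continuous_on_subset [OF cont]) auto
  moreover have "?f x \<ge> 0" for x
  proof (cases "x \<in> cball x0 r")
    case True
    then have "dist x x0 < d" using d(1) by (simp add: r_def dist_commute)
    from d(2) [OF this] have "sgn (w x0) * w x \<ge> 0"
      by (auto simp: sgn_if abs_if split: if_splits)
    with \<phi>(2) [of x] show ?thesis
      by (metis mult.left_commute mult_nonneg_nonneg)
  next
    case False
    then show ?thesis by (simp add: \<phi>)
  qed
  moreover have "x0 \<in> box (- a) a" using a \<open>r > 0\<close> by auto
  ultimately have "?f x0 = 0"
    using has_integral_0_cbox_imp_0 [of "- a" a ?f x0] box_subset_cbox by blast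
  with \<phi>(3) \<open>w x0 \<noteq> 0\<close> show False by (simp add: sgn_zero_iff)
qed

text \<open>The coefficients are continuous and K is compact, so the integral splits into a
  quadratic polynomial in \<epsilon>, whose derivative at 0 is the linear coefficient.\<close>

lemma has_vector_derivative_quadratic_integral:
  fixes L :: "real \<Rightarrow> real^4 \<Rightarrow> complex"
  assumes "continuous_on UNIV a" "continuous_on UNIV b" "continuous_on UNIV c" "compact K"
    and L: "\<And>\<epsilon> x. L \<epsilon> x = a x + \<epsilon> *\<^sub>R b x + \<epsilon>\<^sup>2 *\<^sub>R c x"
  shows "((\<lambda>\<epsilon>. LINT x:K|lborel. L \<epsilon> x) has_vector_derivative (LINT x:K|lborel. b x)) (at 0)"
proof -
  have "(LINT x:K|lborel. L \<epsilon> x)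
    = (LINT x:K|lborel. a x) + \<epsilon> *\<^sub>R (LINT x:K|lborel. b x) + \<epsilon>\<^sup>2 *\<^sub>R (LINT x:K|lborel. c x)" for \<epsilon>
    unfolding L
    by (subst set_integral_add(2); (intro set_integrable_continuous continuous_intros assms)?)
      (subst set_integral_add(2); (intro set_integrable_continuous continuous_intros assms)?; simp)
  then show ?thesis
    by (auto intro!: derivative_eq_intros)
qed

section \<open>The Lagrangian as a quadratic form\<close>

lemma lower_eq: "lower A \<alpha> x = eta \<alpha> \<alpha> * A x $ \<alpha>"
  using sum_eta [of \<alpha> "\<lambda>\<beta>. A x $ \<beta>"] by (simp add: lower_def)

lemma gamma_up_eq: "gamma_up \<alpha> = eta \<alpha> \<alpha> *\<^sub>R gamma \<alpha>"
  by (simp add: gamma_up_def sum_eta)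

lemma pd_up_eq: "pd_up \<alpha> f x = eta \<alpha> \<alpha> *\<^sub>R pd \<alpha> f x"
  by (simp add: pd_up_def sum_eta)

definition jac :: "(real^4 \<Rightarrow> real^4) \<Rightarrow> real^4 \<Rightarrow> 4 \<Rightarrow> 4 \<Rightarrow> real" where
  "jac A x \<alpha> \<beta> = pd \<alpha> (\<lambda>y. A y $ \<beta>) x"

text \<open>Polar form of the bracket in L_V. With D \<alpha> \<beta> the derivative of A^\<beta> in
  direction \<alpha>, the two metric signs raise the derivative index and lower the field index of
  the second factor.\<close>

definition jac_form :: "(4 \<Rightarrow> 4 \<Rightarrow> real) \<Rightarrow> (4 \<Rightarrow> 4 \<Rightarrow> real) \<Rightarrow> real" where
  "jac_form D E = (\<Sum>\<alpha>\<in>UNIV. \<Sum>\<beta>\<in>UNIV. eta \<alpha> \<alpha> * eta \<beta> \<beta> * (D \<alpha> \<beta> * E \<alpha> \<beta>) - D \<alpha> \<beta> * E \<beta> \<alpha>)"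

lemma smooth_jac: "smooth A \<Longrightarrow> smooth (\<lambda>x. jac A x \<alpha> \<beta>)"
  unfolding jac_def by (intro smooth_pd smooth_component)

lemma smooth_jac_form:
  assumes "smooth A" "smooth B"
  shows "smooth (\<lambda>x. jac_form (jac A x) (jac B x))"
  unfolding jac_form_def
  by (intro smooth_sum smooth_diff smooth_mult smooth_const smooth_jac assms)

lemma pd_lower:
  assumes "smooth A"
  shows "pd \<alpha> (lower A \<beta>) x = eta \<beta> \<beta> * jac A x \<alpha> \<beta>"
proof -
  have "lower A \<beta> = (\<lambda>y. eta \<beta> \<beta> * A y $ \<beta>)" by (rule ext) (rule lower_eq)
  then show ?thesis
    using pd_bounded_linear [OF bounded_linear_mult_right smooth_differentiable [OF smooth_component [OF assms]]]
    by (simp add: jac_def)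
qed

lemma jac_form_commute: "jac_form D E = jac_form E D"
proof -
  have "(\<Sum>\<alpha>\<in>UNIV. \<Sum>\<beta>\<in>UNIV. D \<alpha> \<beta> * E \<beta> \<alpha>) = (\<Sum>\<alpha>\<in>UNIV. \<Sum>\<beta>\<in>UNIV. E \<alpha> \<beta> * D \<beta> \<alpha>)"
    by (subst sum.swap) (simp add: mult.commute)
  then show ?thesis by (simp add: jac_form_def sum_subtractf mult.commute)
qed

lemma jac_form_add_scale:
  "jac_form (\<lambda>\<alpha> \<beta>. D \<alpha> \<beta> + r * E \<alpha> \<beta>) (\<lambda>\<alpha> \<beta>. D \<alpha> \<beta> + r * E \<alpha> \<beta>)
     = jac_form D D + 2 * r * jac_form D E + r\<^sup>2 * jac_form E E"
proof -
  have "jac_form (\<lambda>\<alpha> \<beta>. D \<alpha> \<beta> + r * E \<alpha> \<beta>) (\<lambda>\<alpha> \<beta>. D \<alpha> \<beta> + r * E \<alpha> \<beta>)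
    = jac_form D D + r * jac_form D E + r * jac_form E D + r\<^sup>2 * jac_form E E"
    unfolding jac_form_def sum_distrib_left sum.distrib [symmetric]
    by (intro sum.cong refl) (simp add: algebra_simps power2_eq_square)
  then show ?thesis by (simp add: jac_form_commute [of E D])
qed

lemma jac_add_scaleR:
  assumes "smooth A" "smooth h"
  shows "jac (\<lambda>y. A y + r *\<^sub>R h y) x = (\<lambda>\<alpha> \<beta>. jac A x \<alpha> \<beta> + r * jac h x \<alpha> \<beta>)"
proof (intro ext)
  fix \<alpha> \<beta>
  note d = smooth_differentiable [OF smooth_component [OF assms(1)]]
    smooth_differentiable [OF smooth_component [OF assms(2)]]
  show "jac (\<lambda>y. A y + r *\<^sub>R h y) x \<alpha> \<beta> = jac A x \<alpha> \<beta> + r * jac h x \<alpha> \<beta>"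
    using pd_add [OF d(1) differentiable_bounded_linear [OF bounded_linear_mult_right d(2)]]
      pd_bounded_linear [OF bounded_linear_mult_right d(2)]
    by (simp add: jac_def)
qed

section \<open>The vector Lagrangian\<close>

definition i_expJ :: "real \<Rightarrow> operator" where
  "i_expJ \<zeta> = map_matrix ((*) \<i>) (expJ \<zeta>)"

text \<open>With the factor i absorbed into the constant matrix, the gauge field depends on the
  point only through a real scalar; hence all derivatives and products are real multiples of
  \<open>i_expJ\<close> and its square.\<close>

lemma M_field_eq: "M_field \<zeta> A \<alpha> x = lower A \<alpha> x *\<^sub>R i_expJ \<zeta>"
  by (simp add: M_field_def i_expJ_def map_matrix_def vec_eq_iff)
    (simp add: scaleR_conv_of_real mult_ac)

lemma i_expJ_sq: "i_expJ \<zeta> ** i_expJ \<zeta> = - (expJ \<zeta> ** expJ \<zeta>)"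
proof -
  have "(\<i> * a) * (\<i> * b) = - (a * b)" for a b :: complex
    using i_squared by algebra
  then show ?thesis
    by (simp add: i_expJ_def map_matrix_def matrix_matrix_mult_def vec_eq_iff sum_negf)
qed

lemma i_expJ_vector: "i_expJ \<zeta> *v \<psi> = \<i> *s (expJ \<zeta> *v \<psi>)"
  by (simp add: i_expJ_def map_matrix_def matrix_vector_mult_def vec_eq_iff sum_distrib_left mult.assoc)

lemma Omega_M_field:
  assumes "smooth A"
  shows "Omega (M_field \<zeta> A) \<alpha> \<beta> x = (eta \<beta> \<beta> * jac A x \<alpha> \<beta> - eta \<alpha> \<alpha> * jac A x \<beta> \<alpha>) *\<^sub>R i_expJ \<zeta>"
proof -
  have lower: "smooth (lower A \<beta>)" for \<beta>
    unfolding lower_eq [abs_def] by (intro smooth_mult smooth_const smooth_component assms)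
  have "pd \<alpha> (M_field \<zeta> A \<beta>) x = (eta \<beta> \<beta> * jac A x \<alpha> \<beta>) *\<^sub>R i_expJ \<zeta>" for \<alpha> \<beta>
    unfolding M_field_eq [abs_def]
    using pd_bounded_linear [OF bounded_linear_scaleR_left smooth_differentiable [OF lower]]
    by (simp add: pd_lower [OF assms])
  then show ?thesis
    by (simp add: Omega_def M_field_eq scalar_matrix_assoc [symmetric] matrix_scalar_ac
        mult.commute scaleR_diff_left)
qed

lemma Omega_up_eq: "Omega_up \<theta> \<alpha> \<beta> x = (eta \<alpha> \<alpha> * eta \<beta> \<beta>) *\<^sub>R Omega \<theta> \<alpha> \<beta> x"
proof -
  have "Omega_up \<theta> \<alpha> \<beta> x = (\<Sum>\<mu>\<in>UNIV. eta \<alpha> \<mu> *\<^sub>R (\<Sum>\<nu>\<in>UNIV. eta \<beta> \<nu> *\<^sub>R Omega \<theta> \<mu> \<nu> x))"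
    by (simp add: Omega_up_def scaleR_sum_right)
  also have "\<dots> = eta \<alpha> \<alpha> *\<^sub>R eta \<beta> \<beta> *\<^sub>R Omega \<theta> \<alpha> \<beta> x"
    by (simp only: sum_eta)
  finally show ?thesis by simp
qed

lemma trace_uminus: "trace (- B) = - trace B" for B :: operator
  by (simp add: trace_def sum_negf)

lemma lagrangian_V_M_field:
  assumes "smooth A"
  shows "lagrangian_V (M_field \<zeta> A) x = of_real (- 32 * cos (2 * \<zeta>) * jac_form (jac A x) (jac A x))"
proof -
  let ?F = "\<lambda>\<alpha> \<beta>. eta \<beta> \<beta> * jac A x \<alpha> \<beta> - eta \<alpha> \<alpha> * jac A x \<beta> \<alpha>"
  \<comment> \<open>The signs inside the square disappear from the two square terms and cancel the
    outer signs in the mixed term; exchanging the summation indices then identifies the two square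
    terms.\<close>
  have "(\<Sum>\<alpha>\<in>UNIV. \<Sum>\<beta>\<in>UNIV. eta \<alpha> \<alpha> * eta \<beta> \<beta> * (?F \<alpha> \<beta>)\<^sup>2)
    = (\<Sum>\<alpha>\<in>UNIV. \<Sum>\<beta>\<in>UNIV. eta \<alpha> \<alpha> * eta \<beta> \<beta> * (jac A x \<alpha> \<beta>)\<^sup>2)
      + (\<Sum>\<alpha>\<in>UNIV. \<Sum>\<beta>\<in>UNIV. eta \<alpha> \<alpha> * eta \<beta> \<beta> * (jac A x \<beta> \<alpha>)\<^sup>2)
      - 2 * (\<Sum>\<alpha>\<in>UNIV. \<Sum>\<beta>\<in>UNIV. jac A x \<alpha> \<beta> * jac A x \<beta> \<alpha>)"
    unfolding sum_distrib_left sum.distrib [symmetric] sum_subtractf [symmetric]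
    by (intro sum.cong refl) (auto simp: eta_def power2_eq_square algebra_simps)
  also have "(\<Sum>\<alpha>\<in>UNIV. \<Sum>\<beta>\<in>UNIV. eta \<alpha> \<alpha> * eta \<beta> \<beta> * (jac A x \<beta> \<alpha>)\<^sup>2)
    = (\<Sum>\<alpha>\<in>UNIV. \<Sum>\<beta>\<in>UNIV. eta \<alpha> \<alpha> * eta \<beta> \<beta> * (jac A x \<alpha> \<beta>)\<^sup>2)"
    by (subst sum.swap) (simp add: mult_ac)
  finally have F: "(\<Sum>\<alpha>\<in>UNIV. \<Sum>\<beta>\<in>UNIV. eta \<alpha> \<alpha> * eta \<beta> \<beta> * (?F \<alpha> \<beta>)\<^sup>2) = 2 * jac_form (jac A x) (jac A x)"
    by (simp add: jac_form_def sum_subtractf power2_eq_square)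
  have "(\<Sum>\<alpha>\<in>UNIV. \<Sum>\<beta>\<in>UNIV. Omega (M_field \<zeta> A) \<alpha> \<beta> x ** Omega_up (M_field \<zeta> A) \<alpha> \<beta> x)
    = (\<Sum>\<alpha>\<in>UNIV. \<Sum>\<beta>\<in>UNIV. eta \<alpha> \<alpha> * eta \<beta> \<beta> * (?F \<alpha> \<beta>)\<^sup>2) *\<^sub>R (i_expJ \<zeta> ** i_expJ \<zeta>)"
    by (simp add: Omega_up_eq Omega_M_field [OF assms] scalar_matrix_assoc [symmetric] matrix_scalar_ac
        scaleR_sum_left power2_eq_square mult_ac)
  then have "trace (\<Sum>\<alpha>\<in>UNIV. \<Sum>\<beta>\<in>UNIV. Omega (M_field \<zeta> A) \<alpha> \<beta> x ** Omega_up (M_field \<zeta> A) \<alpha> \<beta> x)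
    = (2 * jac_form (jac A x) (jac A x)) *\<^sub>R - trace (expJ \<zeta> ** expJ \<zeta>)"
    unfolding F by (simp add: trace_scaleR trace_uminus i_expJ_sq)
  then show ?thesis
    by (simp add: lagrangian_V_def plus_cc_def trace_expJ_sq scaleR_conv_of_real)
qed

section \<open>The coupling of the potential to the current\<close>

definition current :: "real \<Rightarrow> multivector \<Rightarrow> 4 \<Rightarrow> real" where
  "current \<zeta> \<psi> \<alpha> = Re (\<i> * eta_form \<psi> (gamma \<alpha> *v (expJ \<zeta> *v \<psi>)))"

text \<open>By \<open>cnj_current\<close> the form value is purely imaginary, so the real part taken
  in \<open>current\<close> discards nothing.\<close>

lemma of_real_current: "of_real (current \<zeta> \<psi> \<alpha>) = \<i> * eta_form \<psi> (gamma \<alpha> *v (expJ \<zeta> *v \<psi>))"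
proof -
  have "\<i> * eta_form \<psi> (gamma \<alpha> *v (expJ \<zeta> *v \<psi>)) \<in> \<real>"
    by (simp add: Reals_cnj_iff cnj_current)
  then show ?thesis by (simp only: current_def of_real_Re)
qed

lemma eta_form_sum_right: "eta_form \<phi> (\<Sum>i\<in>S. \<psi> i) = (\<Sum>i\<in>S. eta_form \<phi> (\<psi> i))"
  by (induction S rule: infinite_finite_induct) (simp_all add: eta_form_add_right, simp_all add: eta_form_eq)

text \<open>The metric sign that raises the index of gamma cancels the one that lowers the index of
  A, leaving A^\<alpha> paired with the lower gamma matrix. Each coupling term is real, so one half
  of it plus its conjugate is the term itself.\<close>

lemma lagrangian_K_M_field:
  "lagrangian_K m (M_field \<zeta> A) \<psi> x
     = lagrangian_K m (\<lambda>_ _. 0) \<psi> x + of_real (\<Sum>\<alpha>\<in>UNIV. A x $ \<alpha> * current \<zeta> (\<psi> x) \<alpha>)"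
proof -
  have "gamma_up \<alpha> *v (M_field \<zeta> A \<alpha> x *v \<psi> x)
    = (A x $ \<alpha>) *\<^sub>R (\<i> *s (gamma \<alpha> *v (expJ \<zeta> *v \<psi> x)))" for \<alpha>
  proof -
    have "B *v (r *\<^sub>R \<phi>) = r *\<^sub>R (B *v \<phi>)" for B :: operator and r \<phi>
      by (simp add: vec_eq_iff matrix_vector_mult_def scaleR_sum_right)
    moreover have "c *s (r *\<^sub>R \<phi>) = r *\<^sub>R (c *s \<phi>)" for c r and \<phi> :: multivector
      by (simp add: vec_eq_iff)
    ultimately show ?thesis
      by (simp add: gamma_up_eq M_field_eq lower_eq i_expJ_vector scaleR_matrix_vector_mult vector_scalar_commute
          mult_ac)
  qed
  then have "eta_form (\<psi> x) (gamma_up \<alpha> *v (M_field \<zeta> A \<alpha> x *v \<psi> x)) = of_real (A x $ \<alpha> * current \<zeta> (\<psi> x) \<alpha>)" for \<alpha>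
    by (simp add: of_real_current eta_form_scaleR eta_form_scale_right)
  then have "eta_form (\<psi> x) (dirac_D (M_field \<zeta> A) \<psi> x) = eta_form (\<psi> x) (dirac_D (\<lambda>_ _. 0) \<psi> x)
      + of_real (\<Sum>\<alpha>\<in>UNIV. A x $ \<alpha> * current \<zeta> (\<psi> x) \<alpha>)"
    by (simp add: dirac_D_def matrix_vector_right_distrib sum.distrib eta_form_add_right eta_form_sum_right)
  then show ?thesis
    by (simp add: lagrangian_K_def plus_cc_def algebra_simps)
qed

lemma continuous_eta_form:
  assumes "continuous_on S \<phi>" "continuous_on S \<psi>"
  shows "continuous_on S (\<lambda>x. eta_form (\<phi> x) (\<psi> x))"
  unfolding eta_form_eq by (intro continuous_intros assms)

lemma continuous_operator_vector_mult:
  fixes B :: operator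
  assumes "continuous_on S \<psi>"
  shows "continuous_on S (\<lambda>x. B *v \<psi> x)"
  unfolding matrix_vector_mult_def by (intro continuous_intros assms)

lemma continuous_current:
  assumes "continuous_on S \<psi>"
  shows "continuous_on S (\<lambda>x. current \<zeta> (\<psi> x) \<alpha>)"
  unfolding current_def
  by (intro continuous_intros continuous_eta_form continuous_operator_vector_mult assms)

lemma continuous_lagrangian_K_free:
  assumes "smooth \<psi>"
  shows "continuous_on S (lagrangian_K m (\<lambda>_ _. 0) \<psi>)"
  unfolding lagrangian_K_def [abs_def] plus_cc_def dirac_D_def
  by (intro continuous_intros continuous_eta_form continuous_operator_vector_mult
      smooth_continuous smooth_pd assms) simp

lemma total_lagrangian_eq:
  assumes "smooth A"
  shows "total_lagrangian m \<tau> \<zeta> \<psi> A x = lagrangian_K m (\<lambda>_ _. 0) \<psi> x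
    + of_real ((\<Sum>\<alpha>\<in>UNIV. A x $ \<alpha> * current \<zeta> (\<psi> x) \<alpha>)
      + 32 * \<tau> * cos (2 * \<zeta>) * jac_form (jac A x) (jac A x))"
  by (simp add: total_lagrangian_def lagrangian_K_M_field lagrangian_V_M_field [OF assms])

section \<open>The first variation\<close>

text \<open>Coefficient of \<epsilon> in the Lagrangian at A + \<epsilon> h; 64 is twice 32 because
  of the cross term in \<open>jac_form_add_scale\<close>.\<close>

definition first_variation :: "real \<Rightarrow> real \<Rightarrow> (real^4 \<Rightarrow> multivector) \<Rightarrow> (real^4 \<Rightarrow> real^4)
    \<Rightarrow> (real^4 \<Rightarrow> real^4) \<Rightarrow> real^4 \<Rightarrow> real" where
  "first_variation \<tau> \<zeta> \<psi> A h x = (\<Sum>\<alpha>\<in>UNIV. h x $ \<alpha> * current \<zeta> (\<psi> x) \<alpha>)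
     + 64 * \<tau> * cos (2 * \<zeta>) * jac_form (jac A x) (jac h x)"

lemma action_has_vector_derivative:
  assumes "smooth A" "smooth \<psi>" "smooth h" "compact K"
  shows "((\<lambda>\<epsilon>. LINT x:K|lborel. total_lagrangian m \<tau> \<zeta> \<psi> (\<lambda>y. A y + \<epsilon> *\<^sub>R h y) x)
    has_vector_derivative of_real (LINT x:K|lborel. first_variation \<tau> \<zeta> \<psi> A h x)) (at 0)"
proof -
  have eq: "total_lagrangian m \<tau> \<zeta> \<psi> (\<lambda>y. A y + \<epsilon> *\<^sub>R h y) x
    = total_lagrangian m \<tau> \<zeta> \<psi> A x + \<epsilon> *\<^sub>R of_real (first_variation \<tau> \<zeta> \<psi> A h x)
      + \<epsilon>\<^sup>2 *\<^sub>R of_real (32 * \<tau> * cos (2 * \<zeta>) * jac_form (jac h x) (jac h x))" for \<epsilon> x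
  proof -
    have "smooth (\<lambda>y. A y + \<epsilon> *\<^sub>R h y)"
      by (intro smooth_add smooth_scaleR smooth_const assms)
    note total = total_lagrangian_eq [OF this] total_lagrangian_eq [OF \<open>smooth A\<close>]
    have "r *\<^sub>R complex_of_real y = of_real (r * y)" for r y
      by (simp add: scaleR_conv_of_real)
    moreover have "(\<Sum>\<alpha>\<in>UNIV. (A x + \<epsilon> *\<^sub>R h x) $ \<alpha> * current \<zeta> (\<psi> x) \<alpha>)
        + 32 * \<tau> * cos (2 * \<zeta>) * jac_form (jac (\<lambda>y. A y + \<epsilon> *\<^sub>R h y) x) (jac (\<lambda>y. A y + \<epsilon> *\<^sub>R h y) x)
      = (\<Sum>\<alpha>\<in>UNIV. A x $ \<alpha> * current \<zeta> (\<psi> x) \<alpha>) + 32 * \<tau> * cos (2 * \<zeta>) * jac_form (jac A x) (jac A x)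
        + \<epsilon> * first_variation \<tau> \<zeta> \<psi> A h x
        + \<epsilon>\<^sup>2 * (32 * \<tau> * cos (2 * \<zeta>) * jac_form (jac h x) (jac h x))"
      by (simp add: jac_add_scaleR assms jac_form_add_scale first_variation_def
          sum.distrib distrib_left distrib_right sum_distrib_left mult_ac)
    ultimately show ?thesis
      unfolding total by (simp only: of_real_add add.assoc)
  qed
  note cont = smooth_continuous [OF smooth_component] smooth_continuous [OF smooth_jac_form]
    continuous_current [OF smooth_continuous]
  have "((\<lambda>\<epsilon>. LINT x:K|lborel. total_lagrangian m \<tau> \<zeta> \<psi> (\<lambda>y. A y + \<epsilon> *\<^sub>R h y) x)
    has_vector_derivative (LINT x:K|lborel. of_real (first_variation \<tau> \<zeta> \<psi> A h x))) (at 0)"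
  proof (rule has_vector_derivative_quadratic_integral [OF _ _ _ \<open>compact K\<close> eq])
    show "continuous_on UNIV (total_lagrangian m \<tau> \<zeta> \<psi> A)"
      unfolding total_lagrangian_eq [OF \<open>smooth A\<close>, abs_def]
      by (intro continuous_intros continuous_lagrangian_K_free cont assms)
    show "continuous_on UNIV (\<lambda>x. complex_of_real (first_variation \<tau> \<zeta> \<psi> A h x))"
      unfolding first_variation_def by (intro continuous_intros cont assms)
    show "continuous_on UNIV (\<lambda>x. complex_of_real (32 * \<tau> * cos (2 * \<zeta>) * jac_form (jac h x) (jac h x)))"
      by (intro continuous_intros cont assms)
  qed
  then show ?thesis by (simp only: set_integral_complex_of_real)
qed

section \<open>The Maxwell operator and the Euler-Lagrange expression\<close>

definition maxwell_lhs :: "(real^4 \<Rightarrow> real^4) \<Rightarrow> 4 \<Rightarrow> real^4 \<Rightarrow> real" where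
  "maxwell_lhs A \<alpha> x = (\<Sum>\<beta>\<in>UNIV. pd \<beta> (pd_up \<beta> (lower A \<alpha>)) x)
     - pd \<alpha> (\<lambda>y. \<Sum>\<beta>\<in>UNIV. pd \<beta> (\<lambda>z. A z $ \<beta>) y) x"

text \<open>The field strength with first index raised and second lowered. In this position it is
  the coefficient of the derivative of h^\<beta> in direction \<alpha> in
  \<open>jac_form\<close>.\<close>

definition field_strength :: "(real^4 \<Rightarrow> real^4) \<Rightarrow> 4 \<Rightarrow> 4 \<Rightarrow> real^4 \<Rightarrow> real" where
  "field_strength A \<alpha> \<beta> x = eta \<alpha> \<alpha> * eta \<beta> \<beta> * jac A x \<alpha> \<beta> - jac A x \<beta> \<alpha>"

lemma smooth_field_strength: "smooth A \<Longrightarrow> smooth (field_strength A \<alpha> \<beta>)"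
  unfolding field_strength_def [abs_def] by (intro smooth_diff smooth_mult smooth_const smooth_jac)

text \<open>The first terms agree up to metric signs; the second ones are derivatives of the
  divergence of A, where the symmetry of second derivatives is used to interchange the two
  directions.\<close>

lemma maxwell_lhs_eq:
  assumes "smooth A"
  shows "maxwell_lhs A \<beta> x = (\<Sum>\<alpha>\<in>UNIV. pd \<alpha> (field_strength A \<alpha> \<beta>) x)"
proof -
  note d = smooth_differentiable [OF smooth_jac [OF assms]]
  have 1: "pd \<alpha> (\<lambda>x. c * jac A x \<beta> \<gamma>) x = c * pd \<alpha> (\<lambda>x. jac A x \<beta> \<gamma>) x" for c \<alpha> \<beta> \<gamma>
    by (rule pd_bounded_linear [OF bounded_linear_mult_right d])
  have "pd \<alpha> (pd_up \<alpha> (lower A \<beta>)) x = eta \<alpha> \<alpha> * eta \<beta> \<beta> * pd \<alpha> (\<lambda>x. jac A x \<alpha> \<beta>) x" for \<alpha>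
    unfolding pd_up_eq [abs_def] pd_lower [OF assms, abs_def] by (simp add: 1 flip: mult.assoc)
  moreover have "pd \<beta> (\<lambda>y. \<Sum>\<alpha>\<in>UNIV. pd \<alpha> (\<lambda>z. A z $ \<alpha>) y) x = (\<Sum>\<alpha>\<in>UNIV. pd \<alpha> (\<lambda>y. jac A y \<beta> \<alpha>) x)"
    using pd_commute [OF smooth_component [OF assms], of \<beta> _ _ x] d
    by (subst pd_sum) (simp_all add: jac_def)
  moreover have "pd \<alpha> (field_strength A \<alpha> \<beta>) x
    = eta \<alpha> \<alpha> * eta \<beta> \<beta> * pd \<alpha> (\<lambda>x. jac A x \<alpha> \<beta>) x - pd \<alpha> (\<lambda>y. jac A y \<beta> \<alpha>) x" for \<alpha>
    unfolding field_strength_def [abs_def] 1 [symmetric]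
    by (rule pd_diff [OF differentiable_bounded_linear [OF bounded_linear_mult_right d] d])
  ultimately show ?thesis by (simp add: maxwell_lhs_def sum_subtractf)
qed

text \<open>The product rule moves the derivative from h to the field strength, leaving minus the
  divergence of the latter, which is \<open>maxwell_lhs\<close>.\<close>

lemma jac_form_eq_divergence:
  assumes "smooth A" "smooth h"
  shows "jac_form (jac A x) (jac h x) = (\<Sum>\<alpha>\<in>UNIV. \<Sum>\<beta>\<in>UNIV. pd \<alpha> (\<lambda>y. field_strength A \<alpha> \<beta> y * h y $ \<beta>) x)
    - (\<Sum>\<beta>\<in>UNIV. h x $ \<beta> * maxwell_lhs A \<beta> x)"
proof -
  \<comment> \<open>Exchanging the indices in the second sum makes h appear in both sums with the
    same derivative, so that the field strength can be factored out.\<close>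
  have "jac_form (jac A x) (jac h x) = (\<Sum>\<alpha>\<in>UNIV. \<Sum>\<beta>\<in>UNIV. eta \<alpha> \<alpha> * eta \<beta> \<beta> * (jac A x \<alpha> \<beta> * jac h x \<alpha> \<beta>))
    - (\<Sum>\<alpha>\<in>UNIV. \<Sum>\<beta>\<in>UNIV. jac A x \<beta> \<alpha> * jac h x \<alpha> \<beta>)"
    unfolding jac_form_def sum_subtractf by (subst (2) sum.swap) simp
  also have "\<dots> = (\<Sum>\<alpha>\<in>UNIV. \<Sum>\<beta>\<in>UNIV. field_strength A \<alpha> \<beta> x * jac h x \<alpha> \<beta>)"
    by (simp add: field_strength_def algebra_simps sum_subtractf)
  also have "\<dots> = (\<Sum>\<alpha>\<in>UNIV. \<Sum>\<beta>\<in>UNIV. pd \<alpha> (\<lambda>y. field_strength A \<alpha> \<beta> y * h y $ \<beta>) x)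
    - (\<Sum>\<alpha>\<in>UNIV. \<Sum>\<beta>\<in>UNIV. pd \<alpha> (field_strength A \<alpha> \<beta>) x * h x $ \<beta>)"
  proof -
    have "pd \<alpha> (\<lambda>y. field_strength A \<alpha> \<beta> y * h y $ \<beta>) x
      = field_strength A \<alpha> \<beta> x * jac h x \<alpha> \<beta> + pd \<alpha> (field_strength A \<alpha> \<beta>) x * h x $ \<beta>" for \<alpha> \<beta>
      using pd_scaleR [OF smooth_differentiable [OF smooth_field_strength [OF assms(1)]]
          smooth_differentiable [OF smooth_component [OF assms(2)]]]
      by (simp add: jac_def)
    then show ?thesis by (simp add: sum.distrib)
  qed
  also have "(\<Sum>\<alpha>\<in>UNIV. \<Sum>\<beta>\<in>UNIV. pd \<alpha> (field_strength A \<alpha> \<beta>) x * h x $ \<beta>) = (\<Sum>\<beta>\<in>UNIV. h x $ \<beta> * maxwell_lhs A \<beta> x)"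
    by (subst sum.swap) (simp add: maxwell_lhs_eq [OF assms(1)] sum_distrib_left mult.commute)
  finally show ?thesis .
qed

definition euler_lagrange :: "real \<Rightarrow> real \<Rightarrow> (real^4 \<Rightarrow> multivector) \<Rightarrow> (real^4 \<Rightarrow> real^4) \<Rightarrow> 4 \<Rightarrow> real^4 \<Rightarrow> real" where
  "euler_lagrange \<tau> \<zeta> \<psi> A \<alpha> x = current \<zeta> (\<psi> x) \<alpha> - 64 * \<tau> * cos (2 * \<zeta>) * maxwell_lhs A \<alpha> x"

lemma continuous_euler_lagrange:
  assumes "smooth A" "smooth \<psi>"
  shows "continuous_on S (euler_lagrange \<tau> \<zeta> \<psi> A \<alpha>)"
  unfolding euler_lagrange_def [abs_def] maxwell_lhs_eq [OF assms(1)]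
  by (intro continuous_intros continuous_current smooth_continuous smooth_pd smooth_field_strength assms)

lemma integral_first_variation:
  assumes "smooth A" "smooth \<psi>" "smooth h" "compact K" "closure {x. h x \<noteq> 0} \<subseteq> K"
  shows "(LINT x:K|lborel. first_variation \<tau> \<zeta> \<psi> A h x)
    = (LINT x:K|lborel. \<Sum>\<alpha>\<in>UNIV. h x $ \<alpha> * euler_lagrange \<tau> \<zeta> \<psi> A \<alpha> x)"
proof -
  let ?div = "\<lambda>\<alpha> \<beta> x. pd \<alpha> (\<lambda>y. field_strength A \<alpha> \<beta> y * h y $ \<beta>) x"
  have smooth: "smooth (\<lambda>y. field_strength A \<alpha> \<beta> y * h y $ \<beta>)" for \<alpha> \<beta>
    by (intro smooth_mult smooth_field_strength smooth_component assms)
  \<comment> \<open>The products of field strength and variation therefore also vanish off K, as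
    \<open>integral_pd_eq_0\<close> demands.\<close>
  have "h x = 0" if "x \<notin> K" for x
    using that assms(5) closure_subset [of "{x. h x \<noteq> 0}"] by auto
  then have div: "(LINT x:K|lborel. ?div \<alpha> \<beta> x) = 0" for \<alpha> \<beta>
    by (intro integral_pd_eq_0 smooth \<open>compact K\<close>) simp
  have int: "set_integrable lborel K (?div \<alpha> \<beta>)" for \<alpha> \<beta>
    by (intro set_integrable_continuous smooth_continuous smooth_pd smooth \<open>compact K\<close>)
  have "(LINT x:K|lborel. \<Sum>\<alpha>\<in>UNIV. \<Sum>\<beta>\<in>UNIV. ?div \<alpha> \<beta> x) = 0"
    by (simp add: set_integral_sum set_integrable_sum int div)
  moreover have "set_integrable lborel K (\<lambda>x. \<Sum>\<alpha>\<in>UNIV. h x $ \<alpha> * euler_lagrange \<tau> \<zeta> \<psi> A \<alpha> x)"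
    by (intro set_integrable_continuous continuous_intros smooth_continuous [OF smooth_component]
        continuous_euler_lagrange assms)
  moreover have "set_integrable lborel K (\<lambda>x. 64 * \<tau> * cos (2 * \<zeta>) * (\<Sum>\<alpha>\<in>UNIV. \<Sum>\<beta>\<in>UNIV. ?div \<alpha> \<beta> x))"
    by (intro set_integrable_continuous continuous_intros smooth_continuous smooth_pd smooth \<open>compact K\<close>)
  moreover have "first_variation \<tau> \<zeta> \<psi> A h x = (\<Sum>\<alpha>\<in>UNIV. h x $ \<alpha> * euler_lagrange \<tau> \<zeta> \<psi> A \<alpha> x)
      + 64 * \<tau> * cos (2 * \<zeta>) * (\<Sum>\<alpha>\<in>UNIV. \<Sum>\<beta>\<in>UNIV. ?div \<alpha> \<beta> x)" for x
  proof -
    have "(\<Sum>\<alpha>\<in>UNIV. h x $ \<alpha> * euler_lagrange \<tau> \<zeta> \<psi> A \<alpha> x) = (\<Sum>\<alpha>\<in>UNIV. h x $ \<alpha> * current \<zeta> (\<psi> x) \<alpha>)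
      - 64 * \<tau> * cos (2 * \<zeta>) * (\<Sum>\<beta>\<in>UNIV. h x $ \<beta> * maxwell_lhs A \<beta> x)"
      by (simp add: euler_lagrange_def right_diff_distrib sum_subtractf sum_distrib_left mult_ac)
    then show ?thesis
      by (simp add: first_variation_def jac_form_eq_divergence [OF assms(1,3)] right_diff_distrib)
  qed
  ultimately show ?thesis by simp
qed

lemma stationary_iff:
  assumes "smooth A" "smooth \<psi>"
  shows "stationary (total_lagrangian m \<tau> \<zeta> \<psi>) A \<longleftrightarrow> (\<forall>\<alpha> x. euler_lagrange \<tau> \<zeta> \<psi> A \<alpha> x = 0)"
proof -
  have deriv: "((\<lambda>\<epsilon>. LINT x:K|lborel. total_lagrangian m \<tau> \<zeta> \<psi> (\<lambda>y. A y + \<epsilon> *\<^sub>R h y) x)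
      has_vector_derivative of_real (LINT x:K|lborel. \<Sum>\<alpha>\<in>UNIV. h x $ \<alpha> * euler_lagrange \<tau> \<zeta> \<psi> A \<alpha> x)) (at 0)"
    if "smooth h" "compact K" "closure {x. h x \<noteq> 0} \<subseteq> K" for h K
    using action_has_vector_derivative [OF assms that(1,2)]
    unfolding integral_first_variation [OF assms that] .
  show ?thesis
  proof
    assume *: "stationary (total_lagrangian m \<tau> \<zeta> \<psi>) A"
    show "\<forall>\<alpha> x. euler_lagrange \<tau> \<zeta> \<psi> A \<alpha> x = 0"
    proof (intro allI, rule fundamental_lemma [OF continuous_euler_lagrange [OF assms]])
      fix \<alpha> and \<phi> :: "real^4 \<Rightarrow> real" and K :: "(real^4) set"
      assume \<phi>: "smooth \<phi>" "compact K" "closure {x. \<phi> x \<noteq> 0} \<subseteq> K"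
      \<comment> \<open>A scalar test function in a single coordinate direction isolates the
        component \<alpha> of the Euler-Lagrange expression.\<close>
      define h where "h x = \<phi> x *\<^sub>R (axis \<alpha> 1 :: real^4)" for x
      have h: "smooth h" unfolding h_def [abs_def] by (intro smooth_scaleR smooth_const \<phi>)
      have "{x. h x \<noteq> 0} = {x. \<phi> x \<noteq> 0}" unfolding h_def by (simp add: axis_eq_0_iff)
      with \<phi>(3) have supp: "closure {x. h x \<noteq> 0} \<subseteq> K" by simp
      from *[unfolded stationary_def, rule_format, OF h \<phi>(2) supp]
      have "(LINT x:K|lborel. \<Sum>\<beta>\<in>UNIV. h x $ \<beta> * euler_lagrange \<tau> \<zeta> \<psi> A \<beta> x) = 0"
        by (simp add: vector_derivative_unique_at [OF deriv [OF h \<phi>(2) supp]] flip: of_real_eq_0_iff [where 'a = complex])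
      moreover have "(\<Sum>\<beta>\<in>UNIV. h x $ \<beta> * euler_lagrange \<tau> \<zeta> \<psi> A \<beta> x) = \<phi> x * euler_lagrange \<tau> \<zeta> \<psi> A \<alpha> x" for x
        by (simp add: h_def axis_def if_distrib if_distribR cong: if_cong)
      ultimately show "(LINT x:K|lborel. \<phi> x * euler_lagrange \<tau> \<zeta> \<psi> A \<alpha> x) = 0" by simp
    qed
  next
    assume "\<forall>\<alpha> x. euler_lagrange \<tau> \<zeta> \<psi> A \<alpha> x = 0"
    with deriv show "stationary (total_lagrangian m \<tau> \<zeta> \<psi>) A"
      unfolding stationary_def by simp
  qed
qed

theorem mainTheorem7:
  fixes A :: "real^4 \<Rightarrow> real^4" and \<zeta> :: real
  assumes "smooth A"
  shows "(\<forall>x. lagrangian_V (M_field \<zeta> A) x = of_real (- 32 * cos (2 * \<zeta>) *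
            (\<Sum>\<alpha>\<in>UNIV. \<Sum>\<beta>\<in>UNIV.
               pd \<alpha> (\<lambda>y. A y $ \<beta>) x * pd_up \<alpha> (lower A \<beta>) x
               - pd \<alpha> (\<lambda>y. A y $ \<beta>) x * pd \<beta> (\<lambda>y. A y $ \<alpha>) x)))
    \<and> (\<forall>(m::real) (\<tau>::real) (\<psi>::real^4 \<Rightarrow> multivector).
         smooth \<psi> \<longrightarrow> \<tau> \<noteq> 0 \<longrightarrow> cos (2 * \<zeta>) \<noteq> 0 \<longrightarrow>
         (stationary (total_lagrangian m \<tau> \<zeta> \<psi>) A \<longleftrightarrow>
          (\<forall>\<alpha> x. of_real ((\<Sum>\<beta>\<in>UNIV. pd \<beta> (pd_up \<beta> (lower A \<alpha>)) x)
                           - pd \<alpha> (\<lambda>y. \<Sum>\<beta>\<in>UNIV. pd \<beta> (\<lambda>z. A z $ \<beta>) y) x)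
             = \<i> / of_real (64 * \<tau> * cos (2 * \<zeta>))
                 * eta_form (\<psi> x) (gamma \<alpha> *v (expJ \<zeta> *v \<psi> x)))))"
proof (intro conjI allI impI)
  fix x
  have "(\<Sum>\<alpha>\<in>UNIV. \<Sum>\<beta>\<in>UNIV. pd \<alpha> (\<lambda>y. A y $ \<beta>) x * pd_up \<alpha> (lower A \<beta>) x
      - pd \<alpha> (\<lambda>y. A y $ \<beta>) x * pd \<beta> (\<lambda>y. A y $ \<alpha>) x) = jac_form (jac A x) (jac A x)"
    unfolding jac_form_def by (simp add: pd_up_eq pd_lower [OF assms] jac_def mult_ac)
  then show "lagrangian_V (M_field \<zeta> A) x = of_real (- 32 * cos (2 * \<zeta>) *
            (\<Sum>\<alpha>\<in>UNIV. \<Sum>\<beta>\<in>UNIV.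
               pd \<alpha> (\<lambda>y. A y $ \<beta>) x * pd_up \<alpha> (lower A \<beta>) x
               - pd \<alpha> (\<lambda>y. A y $ \<beta>) x * pd \<beta> (\<lambda>y. A y $ \<alpha>) x))"
    by (simp only: lagrangian_V_M_field [OF assms])
next
  fix m \<tau> :: real and \<psi> :: "real^4 \<Rightarrow> multivector"
  assume "smooth \<psi>" "\<tau> \<noteq> 0" "cos (2 * \<zeta>) \<noteq> 0"
  let ?k = "64 * \<tau> * cos (2 * \<zeta>)"
  have "?k \<noteq> 0" using \<open>\<tau> \<noteq> 0\<close> \<open>cos (2 * \<zeta>) \<noteq> 0\<close> by simp
  have "euler_lagrange \<tau> \<zeta> \<psi> A \<alpha> x = 0 \<longleftrightarrow> of_real (maxwell_lhs A \<alpha> x)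
    = \<i> / of_real ?k * eta_form (\<psi> x) (gamma \<alpha> *v (expJ \<zeta> *v \<psi> x))" for \<alpha> x
  proof -
    have "\<i> / of_real ?k * eta_form (\<psi> x) (gamma \<alpha> *v (expJ \<zeta> *v \<psi> x)) = of_real (current \<zeta> (\<psi> x) \<alpha> / ?k)"
      unfolding of_real_divide of_real_current by simp
    moreover have "euler_lagrange \<tau> \<zeta> \<psi> A \<alpha> x = 0 \<longleftrightarrow> maxwell_lhs A \<alpha> x = current \<zeta> (\<psi> x) \<alpha> / ?k"
      using \<open>?k \<noteq> 0\<close> by (auto simp: euler_lagrange_def eq_divide_eq mult.commute)
    ultimately show ?thesis by (simp only: of_real_eq_iff)
  qed
  then show "stationary (total_lagrangian m \<tau> \<zeta> \<psi>) A \<longleftrightarrow>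
          (\<forall>\<alpha> x. of_real ((\<Sum>\<beta>\<in>UNIV. pd \<beta> (pd_up \<beta> (lower A \<alpha>)) x)
                           - pd \<alpha> (\<lambda>y. \<Sum>\<beta>\<in>UNIV. pd \<beta> (\<lambda>z. A z $ \<beta>) y) x)
             = \<i> / of_real (64 * \<tau> * cos (2 * \<zeta>))
                 * eta_form (\<psi> x) (gamma \<alpha> *v (expJ \<zeta> *v \<psi> x)))"
    unfolding stationary_iff [OF assms \<open>smooth \<psi>\<close>] maxwell_lhs_def by simp
qed

end
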